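(* For a nonnegative integer $n$, let $P(n)$ denote the number of partitions of $n$ into distinct parts each congruent to one of $-2^3,-2^2,-2^1,-2^0$ modulo $15$ (i.e. congruent to $7,11,13$ or $14$ modulo $15$). Let $G(n)$ denote the number of partitions of $n$ into parts not congruent to any of $2^0,2^1,2^2,2^3$ modulo $15$ (i.e. no part is congruent to $1,2,4$ or $8$ modulo $15$) satisfying all of the following conditions: (i) the difference between any two consecutive parts that are not multiples of $15$ (consecutive in the ordered list of non-multiples of $15$ in the partition) is $\ge 15$, with equality only if a part is relatively prime to $15$; (ii) every part which is not relatively prime to $15$ is $>15$; (iii) the difference between any two consecutive multiples of $15$ in the partition is $\ge 60$; (iv) the smallest multiple of $15$ occurring as a part (if any) is $\ge 30+30\tau$ if $7$ is a part, and $\ge 45+30\tau$ otherwise, where $\tau$ is the number of parts of the partition that are not multiples of $15$. Then $G(n)=P(n)$ for every $n$. *)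

theory Defs
  imports Main
begin

definition P :: "nat \<Rightarrow> nat" where
  "P n = card {S :: nat set. finite S \<and> (\<forall>x\<in>S. 0 < x \<and> x mod 15 \<in> {7, 11, 13, 14})
                              \<and> \<Sum>S = n}"

text \<open>A partition is represented as a (weakly) increasingly sorted list of positive parts.
  The list of non-multiples of 15 and of multiples of 15 are the subsequences of the parts,
  keeping multiplicity and the increasing order.\<close>
definition G_cond :: "nat list \<Rightarrow> bool" where
  "G_cond xs \<longleftrightarrow>
     (let ys = filter (\<lambda>x. \<not> 15 dvd x) xs;
          ms = filter (\<lambda>x. 15 dvd x) xs;
          \<tau> = length ys in
       (\<forall>x\<in>set xs. x mod 15 \<notin> {1, 2, 4, 8})
     \<and> (\<forall>i. Suc i < length ys \<longrightarrow>
           ys ! i + 15 \<le> ys ! Suc i \<and>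
           (ys ! Suc i = ys ! i + 15 \<longrightarrow> coprime (ys ! i) (15::nat)))
     \<and> (\<forall>x\<in>set xs. \<not> coprime x (15::nat) \<longrightarrow> x > 15)
     \<and> (\<forall>i. Suc i < length ms \<longrightarrow> ms ! i + 60 \<le> ms ! Suc i)
     \<and> (ms \<noteq> [] \<longrightarrow>
           hd ms \<ge> (if (7::nat) \<in> set xs then 30 + 30 * \<tau> else 45 + 30 * \<tau>)))"

definition G :: "nat \<Rightarrow> nat" where
  "G n = card {xs :: nat list. sorted xs \<and> (\<forall>x\<in>set xs. 0 < x) \<and> sum_list xs = n \<and> G_cond xs}"

end

theory Submission
  imports Defs "HOL-Computational_Algebra.Formal_Laurent_Series"
begin

text \<open>
  Let \<open>q = x^15\<close> and let \<open>a, b, c, d\<close> be \<open>x\<close> to the powers \<open>-8, -4, -2, -1\<close>. Parts in the residue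
  classes 7, 11, 13, 14 modulo 15 are \<open>a q^k, b q^k, c q^k, d q^k\<close>, the other admissible
  non-multiples of 15 are \<open>ab q^k, ac q^k, ...\<close>, and the multiples are \<open>abcd q^k\<close>.
  In a partition with \<open>n\<close> multiples and \<open>t\<close> non-multiples of 15, raise every non-multiple by
  \<open>30 n\<close> and lower every multiple by \<open>30 t\<close>: this preserves the sum and makes the bound (iv) on
  the multiples independent of \<open>t\<close>.

  Let \<open>T(M)\<close> be the generating function of the shifted pairs with all non-multiples below \<open>15 M\<close>.
  Removing the largest non-multiple gives recurrences, which for
  \<open>F(X) = sum over M of T(M) q^(-M(M+1)/2) X^M\<close> collapse to one equation, symmetric in
  \<open>a, b, c, d\<close>:
  \<open>(1-aX)(1-bX)(1-cX)(1-dX) F(X) = (1+abX)(1+acX)...(1+cdX) (X/q) F(X/q) + S(X) D(X)\<close>,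
  where \<open>D(X) = sum over n of (abcd X^2)^n / ((1-q)...(1-q^n))\<close> and \<open>S\<close> is a polynomial.
  Such an equation has only one solution, and this forces
  \<open>(1+adqX)(1+bdqX)(1+cdqX) F(X; d) = (1+dq)(1-dqX) F(X; dq) - dq D(X; dq^2)\<close>.
  Multiplication by \<open>X\<close> brings a factor \<open>q^M\<close> into the coefficients, so that for \<open>M\<close> tending to
  infinity only \<open>T(d) = (1+dq) T(dq)\<close> survives; iterating this in all four variables gives the
  product that counts the partitions into distinct parts.
\<close>

section \<open>Linear q-difference equations\<close>

definition fps_dilate :: "'a::comm_ring_1 \<Rightarrow> 'a fps \<Rightarrow> 'a fps" where
  "fps_dilate p F = Abs_fps (\<lambda>n. p ^ n * fps_nth F n)"

lemma fps_dilate_nth [simp]: "fps_nth (fps_dilate p F) n = p ^ n * fps_nth F n"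
  by (simp add: fps_dilate_def)

lemma fps_dilate_add [simp]: "fps_dilate p (F + H) = fps_dilate p F + fps_dilate p H"
  by (rule fps_ext) (simp add: algebra_simps)

lemma fps_dilate_diff [simp]: "fps_dilate p (F - H) = fps_dilate p F - fps_dilate p H"
  by (rule fps_ext) (simp add: algebra_simps)

lemma fps_dilate_mult [simp]: "fps_dilate p (F * H) = fps_dilate p F * fps_dilate p H"
proof (rule fps_ext)
  fix n
  have "p ^ n * (fps_nth F i * fps_nth H (n - i)) =
      p ^ i * fps_nth F i * (p ^ (n - i) * fps_nth H (n - i))" if "i \<le> n" for i
    using power_add[of p i "n - i"] that by (simp add: algebra_simps)
  then show "fps_nth (fps_dilate p (F * H)) n = fps_nth (fps_dilate p F * fps_dilate p H) n"
    by (auto simp: fps_mult_nth sum_distrib_left intro!: sum.cong)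
qed

lemma fps_dilate_const [simp]: "fps_dilate p (fps_const c) = fps_const c"
  by (rule fps_ext) simp

lemma fps_dilate_1 [simp]: "fps_dilate p 1 = 1"
  using fps_dilate_const[of p 1] by (simp del: fps_dilate_const)

lemma fps_dilate_X [simp]: "fps_dilate p fps_X = fps_const p * fps_X"
  by (rule fps_ext) (auto simp: fps_X_def)

text \<open>The factor \<open>fps_X\<close> makes coefficient n of the right side depend only on
  coefficients of \<open>W\<close> below n; on the left it is \<open>fps_nth W n\<close> plus
  multiples of lower ones. Hence all coefficients vanish by induction.\<close>

lemma dilate_equation_unique:
  fixes W :: "'a::comm_ring_1 fps"
  assumes "U * W = R * (fps_X * fps_dilate p W)" and U0: "fps_nth U 0 = 1"
  shows "W = 0"
proof -
  have "fps_nth W n = 0" for n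
  proof (induction n rule: less_induct)
    case (less n)
    have "fps_nth (U * W) n = fps_nth U 0 * fps_nth W n + (\<Sum>i=1..n. fps_nth U i * fps_nth W (n - i))"
      by (simp add: fps_mult_nth sum.atLeast_Suc_atMost)
    also have "(\<Sum>i=1..n. fps_nth U i * fps_nth W (n - i)) = 0"
      using less by (intro sum.neutral) auto
    finally have "fps_nth (U * W) n = fps_nth W n"
      by (simp add: U0)
    moreover have "fps_nth (R * (fps_X * fps_dilate p W)) n = 0"
      unfolding fps_mult_nth[of R] by (intro sum.neutral) (auto simp: less)
    ultimately show ?case
      using assms(1) by simp
  qed
  then show ?thesis
    by (intro fps_ext) simp
qed

definition qprod :: "'a::field \<Rightarrow> nat \<Rightarrow> 'a" where
  "qprod q n = (\<Prod>i=1..n. 1 - q ^ i)"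

text \<open>The series \<open>D\<close>, with \<open>e = abcd\<close>.\<close>

definition qexp :: "'a::field \<Rightarrow> 'a \<Rightarrow> 'a fps" where
  "qexp q e = Abs_fps (\<lambda>n. if even n then e ^ (n div 2) / qprod q (n div 2) else 0)"

lemma qprod_0 [simp]: "qprod q 0 = 1"
  by (simp add: qprod_def)

lemma qprod_Suc: "qprod q (Suc n) = qprod q n * (1 - q ^ Suc n)"
  by (simp add: qprod_def)

lemma qprod_nonzero: "(\<And>n. n > 0 \<Longrightarrow> q ^ n \<noteq> 1) \<Longrightarrow> qprod q n \<noteq> 0"
  by (induction n) (auto simp: qprod_Suc simp del: power_Suc)

text \<open>By Euler, \<open>qexp q e\<close> is formally the inverse of the product of all
  \<open>1 - e q^k X^2\<close> with k >= 0; replacing \<open>e\<close> by \<open>e * q\<close> drops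
  the factor k = 0.\<close>

lemma qexp_mult:
  fixes q :: "'a::field"
  assumes "\<And>n. n > 0 \<Longrightarrow> q ^ n \<noteq> 1"
  shows "qexp q (e * q) = (1 - fps_const e * fps_X\<^sup>2) * qexp q e"
proof (rule fps_ext)
  fix n
  have eq: "fps_nth ((1 - fps_const e * fps_X\<^sup>2) * qexp q e) n =
      fps_nth (qexp q e) n - e * (if n < 2 then 0 else fps_nth (qexp q e) (n - 2))"
    by (simp add: left_diff_distrib mult.assoc fps_X_power_mult_nth)
  show "fps_nth (qexp q (e * q)) n = fps_nth ((1 - fps_const e * fps_X\<^sup>2) * qexp q e) n"
  proof (cases "even n \<and> n \<ge> 2")
    case True
    then obtain m where n: "n = 2 * Suc m"
      by (metis One_nat_def dvdE le_numeral_extra(4) mult_0_right not0_implies_Suc not_numeral_le_zero)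
    have "1 - q ^ Suc m \<noteq> 0" "qprod q m \<noteq> 0"
      using assms[of "Suc m"] qprod_nonzero[OF assms] by (auto simp del: power_Suc)
    then show ?thesis
      unfolding eq by (simp add: n qexp_def qprod_Suc divide_simps power_mult_distrib del: power_Suc)
        (simp add: algebra_simps)
  next
    case False
    then show ?thesis
      unfolding eq by (cases "n = 0") (auto simp: qexp_def)
  qed
qed

text \<open>\<open>e\<close> and \<open>X\<close> enter only through \<open>e X^2\<close>, so
  \<open>X -> X/q\<close> undoes \<open>e -> e q^2\<close>.\<close>

lemma qexp_dilate:
  "p * q = (1::'a::field) \<Longrightarrow> fps_dilate p (qexp q (e * q\<^sup>2)) = qexp q e"
proof (rule fps_ext)
  fix n assume pq: "p * q = 1"
  have "p ^ (2 * m) * (e * q\<^sup>2) ^ m = e ^ m" for m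
  proof -
    have "p ^ (2 * m) * (e * q\<^sup>2) ^ m = e ^ m * (p * q) ^ (2 * m)"
      by (simp add: power_mult_distrib power_mult)
    then show ?thesis by (simp add: pq)
  qed
  then show "fps_nth (fps_dilate p (qexp q (e * q\<^sup>2))) n = fps_nth (qexp q e) n"
    by (auto simp: qexp_def elim!: evenE)
qed

text \<open>The polynomial \<open>S\<close>.\<close>

definition source :: "'a::comm_ring_1 \<Rightarrow> 'a \<Rightarrow> 'a \<Rightarrow> 'a \<Rightarrow> 'a \<Rightarrow> 'a" where
  "source X a b c d = 1 + (a*b*c + a*b*d + a*c*d + b*c*d - a*b*c*d) * X^2
     + a*b*c*d * (a + b + c + d - 1) * X^3 + (a*b*c*d)^2 * X^5"

text \<open>Balances the inhomogeneous terms in \<open>gf_equation_step\<close>: the sources for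
  \<open>d\<close> and for \<open>d*q\<close>, together with the added \<open>qexp\<close> term,
  leave only the last summand. That one is a multiple of \<open>X\<close> and fits the right side of
  a homogeneous equation.\<close>

lemma source_identity:
  fixes X a b c d q :: "'a::idom"
  shows "(1 + a*d*q*X) * (1 + b*d*q*X) * (1 + c*d*q*X) * source X a b c d
      + d*q * ((1 - a*X) * (1 - b*X) * (1 - c*X) * (1 - d*X) * (1 - a*b*c*d*q*X^2) * (1 - a*b*c*d*X^2))
    = (1 + d*q) * (1 - d*X) * (1 - a*b*c*d*X^2) * source X a b c (d*q)
      + d * X * (1 + a*b*X) * (1 + a*c*X) * (1 + b*c*X)
        * (1 + a*d*q*X) * (1 + b*d*q*X) * (1 + c*d*q*X)"
  unfolding source_def by algebra

section \<open>The functional equation and its behaviour under \<open>d -> d q\<close>\<close>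

definition gf_equation :: "'a::field \<Rightarrow> 'a \<Rightarrow> 'a \<Rightarrow> 'a \<Rightarrow> 'a \<Rightarrow> 'a fps \<Rightarrow> bool" where
  "gf_equation q a b c d F \<longleftrightarrow>
     (let X = fps_X; A = fps_const a; B = fps_const b; C = fps_const c; D = fps_const d in
       (1 - A*X) * (1 - B*X) * (1 - C*X) * (1 - D*X) * F =
       (1 + A*B*X) * (1 + A*C*X) * (1 + A*D*X) * (1 + B*C*X) * (1 + B*D*X) * (1 + C*D*X)
         * (fps_const (inverse q) * X * fps_dilate (inverse q) F)
       + source X A B C D * qexp q (a*b*c*d))"

text \<open>The equation is symmetric in the four letters. Powers of the rotation bring each letter
  into the last place, where \<open>gf_equation_step\<close> acts.\<close>

lemma gf_equation_rotate: "gf_equation q a b c d F \<longleftrightarrow> gf_equation q b c d a F"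
proof -
  have "source X a b c d = source X b c d a" for X a b c d :: "'a fps"
    unfolding source_def by algebra
  note this[of fps_X "fps_const a" "fps_const b" "fps_const c" "fps_const d"]
  then show ?thesis
    unfolding gf_equation_def Let_def by (simp only: ac_simps)
qed

text \<open>\<open>G\<close> and \<open>G'\<close> stand for \<open>F(X/q)\<close> and
  \<open>F'(X/q)\<close>, \<open>p\<close> for \<open>1/q\<close>. The bracket on the right is the
  one on the left after \<open>X -> X/q\<close>, so the combination satisfies an equation as in
  \<open>dilate_equation_unique\<close>.\<close>

lemma gf_equation_step_algebra:
  fixes X a b c d q p F F' G G' D S S' :: "'a::idom"
  assumes pq: "p * q = 1"
    and F: "(1 - a*X) * (1 - b*X) * (1 - c*X) * (1 - d*X) * F =
       (1 + a*b*X) * (1 + a*c*X) * (1 + a*d*X) * (1 + b*c*X) * (1 + b*d*X) * (1 + c*d*X) * (p*X*G) + S * D"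
    and F': "(1 - a*X) * (1 - b*X) * (1 - c*X) * (1 - d*q*X) * F' =
       (1 + a*b*X) * (1 + a*c*X) * (1 + a*d*q*X) * (1 + b*c*X) * (1 + b*d*q*X) * (1 + c*d*q*X) * (p*X*G')
         + S' * ((1 - a*b*c*d*X^2) * D)"
    and S: "(1 + a*d*q*X) * (1 + b*d*q*X) * (1 + c*d*q*X) * S
      + d*q * ((1 - a*X) * (1 - b*X) * (1 - c*X) * (1 - d*X) * (1 - a*b*c*d*q*X^2) * (1 - a*b*c*d*X^2))
    = (1 + d*q) * (1 - d*X) * (1 - a*b*c*d*X^2) * S'
      + d * X * (1 + a*b*X) * (1 + a*c*X) * (1 + b*c*X)
        * (1 + a*d*q*X) * (1 + b*d*q*X) * (1 + c*d*q*X)"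
  shows "(1 - a*X) * (1 - b*X) * (1 - c*X) * (1 - d*X)
      * ((1 + a*d*q*X) * (1 + b*d*q*X) * (1 + c*d*q*X) * F - (1 + d*q) * (1 - d*q*X) * F'
          + d*q * ((1 - a*b*c*d*q*X^2) * (1 - a*b*c*d*X^2) * D))
    = (1 + a*b*X) * (1 + a*c*X) * (1 + b*c*X) * (1 + a*d*q*X) * (1 + b*d*q*X) * (1 + c*d*q*X) * p
      * (X * ((1 + a*d*X) * (1 + b*d*X) * (1 + c*d*X) * G - (1 + d*q) * (1 - d*X) * G' + d*q*D))"
proof -
  define L where "L = (1 + a*d*q*X) * (1 + b*d*q*X) * (1 + c*d*q*X)"
  define M where "M = (1 + a*d*X) * (1 + b*d*X) * (1 + c*d*X)"
  define P where "P = (1 + a*b*X) * (1 + a*c*X) * (1 + b*c*X)"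
  define R where "R = (1 - a*X) * (1 - b*X) * (1 - c*X)"
  define u where "u = 1 - a*b*c*d*X^2"
  define v where "v = 1 - a*b*c*d*q*X^2"
  have F1: "R * (1 - d*X) * F = P * M * (p*X*G) + S * D"
    using F unfolding R_def P_def M_def by (simp add: ac_simps)
  have F1': "R * (1 - d*q*X) * F' = P * L * (p*X*G') + S' * (u * D)"
    using F' unfolding R_def P_def L_def u_def by (simp add: ac_simps)
  have S1: "L * S + d*q * (R * (1 - d*X) * v * u) = (1 + d*q) * (1 - d*X) * u * S' + d * X * P * L"
    using S unfolding R_def P_def L_def u_def v_def by (simp add: ac_simps)
  \<comment> \<open>Take \<open>L\<close> times \<open>F1\<close> minus
    \<open>(1 + d*q) * (1 - d*X)\<close> times \<open>F1'\<close>: the terms in \<open>G\<close> and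
    \<open>G'\<close> share \<open>P * L * p * X\<close>. By \<open>S1\<close> the terms in
    \<open>D\<close> add up to \<open>d*X*P*L*D\<close>, which is \<open>P*L*p*X * (d*q*D)\<close>
    because \<open>p * q = 1\<close>.\<close>
  have "R * (1 - d*X) * (L * F - (1 + d*q) * (1 - d*q*X) * F' + d*q * (v * u * D))
      = P * L * p * (X * (M * G - (1 + d*q) * (1 - d*X) * G' + d*q*D))"
    using F1 F1' S1 pq by algebra
  then show ?thesis
    unfolding R_def P_def L_def M_def u_def v_def by (simp only: mult.assoc)
qed

theorem gf_equation_step:
  fixes q :: "'a::field"
  assumes q: "\<And>n. n > 0 \<Longrightarrow> q ^ n \<noteq> 1" "q \<noteq> 0"
    and F: "gf_equation q a b c d F" and F': "gf_equation q a b c (d * q) F'"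
  shows "(1 + fps_const (a*d*q) * fps_X) * (1 + fps_const (b*d*q) * fps_X) * (1 + fps_const (c*d*q) * fps_X) * F
    = fps_const (1 + d*q) * (1 - fps_const (d*q) * fps_X) * F' - fps_const (d*q) * qexp q (a*b*c*d*q\<^sup>2)"
proof -
  define X p where "X = (fps_X :: 'a fps)" and "p = inverse q"
  define A B C D Q where "A = fps_const a" and "B = fps_const b" and "C = fps_const c"
    and "D = fps_const d" and "Q = fps_const q"
  define E where "E = qexp q (a*b*c*d)"
  have e: "fps_const (a*b*c*d) = A*B*C*D"
    by (simp add: A_def B_def C_def D_def)
  have E1: "qexp q (a*b*c*(d*q)) = (1 - A*B*C*D * X\<^sup>2) * E"
    using qexp_mult[OF q(1), of "a*b*c*d"] unfolding E_def X_def e by (simp only: mult.assoc)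
  \<comment> \<open>Two uses of \<open>qexp_mult\<close> make every \<open>qexp\<close> a multiple
    of the single series \<open>E\<close>.\<close>
  have E2: "qexp q (a*b*c*d*q\<^sup>2) = (1 - A*B*C*D*Q * X\<^sup>2) * (1 - A*B*C*D * X\<^sup>2) * E"
  proof -
    have "qexp q (a*b*c*d*q\<^sup>2) = qexp q (a*b*c*d*q*q)"
      by (simp add: power2_eq_square mult.assoc)
    also have "\<dots> = (1 - fps_const (a*b*c*d*q) * X\<^sup>2) * qexp q (a*b*c*d*q)"
      unfolding X_def by (rule qexp_mult[OF q(1)])
    also have "qexp q (a*b*c*d*q) = (1 - A*B*C*D * X\<^sup>2) * E"
      using E1 by (simp only: mult.assoc)
    finally show ?thesis
      by (simp add: A_def B_def C_def D_def Q_def mult.assoc)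
  qed
  have dE: "fps_dilate p ((1 - A*B*C*D*Q * X\<^sup>2) * (1 - A*B*C*D * X\<^sup>2) * E) = E"
    using qexp_dilate[of p q "a*b*c*d"] q(2) unfolding E2[symmetric] by (simp add: E_def p_def)
  have pq: "fps_const p * Q = 1"
    using q(2) by (simp add: p_def Q_def)
  \<comment> \<open>The difference of the two sides of the claim; it solves a homogeneous equation
    and therefore vanishes.\<close>
  define W where "W = (1 + A*D*Q*X) * (1 + B*D*Q*X) * (1 + C*D*Q*X) * F - (1 + D*Q) * (1 - D*Q*X) * F'
          + D*Q * ((1 - A*B*C*D*Q*X^2) * (1 - A*B*C*D*X^2) * E)"
  have dil: "fps_dilate p A = A" "fps_dilate p B = B" "fps_dilate p C = C" "fps_dilate p D = D"
      "fps_dilate p Q = Q" "fps_dilate p X = fps_const p * X"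
    by (simp_all add: A_def B_def C_def D_def Q_def X_def)
  have shift: "U * Q * (fps_const p * X) = U * X" for U
    using pq by algebra
  have dW: "fps_dilate p W = (1 + A*D*X) * (1 + B*D*X) * (1 + C*D*X) * fps_dilate p F
       - (1 + D*Q) * (1 - D*X) * fps_dilate p F' + D*Q*E"
    unfolding W_def fps_dilate_add fps_dilate_diff fps_dilate_mult[of _ "D * Q"]
      dE fps_dilate_mult[of _ _ F] fps_dilate_mult[of _ _ F']
    by (simp only: fps_dilate_add fps_dilate_diff fps_dilate_mult dil fps_dilate_1 shift)
  have F1: "(1 - A*X) * (1 - B*X) * (1 - C*X) * (1 - D*X) * F =
       (1 + A*B*X) * (1 + A*C*X) * (1 + A*D*X) * (1 + B*C*X) * (1 + B*D*X) * (1 + C*D*X)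
         * (fps_const p * X * fps_dilate p F) + source X A B C D * E"
    using F by (simp add: gf_equation_def Let_def X_def p_def A_def B_def C_def D_def E_def
        del: fps_const_mult)
  have DQ: "fps_const (d * q) = D * Q"
    by (simp add: D_def Q_def)
  have F2: "(1 - A*X) * (1 - B*X) * (1 - C*X) * (1 - D*Q*X) * F' =
       (1 + A*B*X) * (1 + A*C*X) * (1 + A*D*Q*X) * (1 + B*C*X) * (1 + B*D*Q*X) * (1 + C*D*Q*X)
         * (fps_const p * X * fps_dilate p F') + source X A B C (D*Q) * ((1 - A*B*C*D * X\<^sup>2) * E)"
    using F' unfolding gf_equation_def Let_def E1 DQ X_def[symmetric] p_def[symmetric]
      A_def[symmetric] B_def[symmetric] C_def[symmetric] by (simp only: mult.assoc)
  have "(1 - A*X) * (1 - B*X) * (1 - C*X) * (1 - D*X) * W =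
     (1 + A*B*X) * (1 + A*C*X) * (1 + B*C*X) * (1 + A*D*Q*X) * (1 + B*D*Q*X) * (1 + C*D*Q*X) * fps_const p
      * (X * fps_dilate p W)"
    unfolding dW unfolding W_def by (rule gf_equation_step_algebra[OF pq F1 F2 source_identity])
  then have "W = 0"
    unfolding X_def by (rule dilate_equation_unique) simp
  moreover have "fps_const (a*d*q) = A*D*Q" "fps_const (b*d*q) = B*D*Q" "fps_const (c*d*q) = C*D*Q"
      "fps_const (1 + d*q) = 1 + D*Q"
    by (simp_all add: A_def B_def C_def D_def Q_def flip: fps_const_add)
  ultimately show ?thesis
    unfolding E2 DQ X_def[symmetric] W_def by (simp add: algebra_simps)
qed

text \<open>Both solutions have the same source, so their difference solves the homogeneous
  equation.\<close>

lemma gf_equation_unique: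
  fixes q :: "'a::field"
  assumes "gf_equation q a b c d F" "gf_equation q a b c d F'"
  shows "F = F'"
proof -
  have "F - F' = 0"
    by (rule dilate_equation_unique[where p = "inverse q" and
      U = "(1 - fps_const a * fps_X) * (1 - fps_const b * fps_X) * (1 - fps_const c * fps_X) * (1 - fps_const d * fps_X)"
      and R = "(1 + fps_const a * fps_const b * fps_X) * (1 + fps_const a * fps_const c * fps_X) * (1 + fps_const a * fps_const d * fps_X)
        * (1 + fps_const b * fps_const c * fps_X) * (1 + fps_const b * fps_const d * fps_X) * (1 + fps_const c * fps_const d * fps_X)
        * fps_const (inverse q)"])
      (use assms in \<open>simp_all add: gf_equation_def Let_def right_diff_distrib mult.assoc del: fps_const_mult\<close>)
  then show ?thesis by simp
qed

section \<open>Generating functions of bounded partitions\<close>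

text \<open>
  \<open>nonmult_gf w s L B\<close> is the generating function of the possible lists of non-multiples of 15 in
  \<open>{L<..B}\<close>, where \<open>L = 30 n\<close> is the shift. The least possible part \<open>L + 7\<close> is the shifted 7; it
  carries the extra factor \<open>s\<close>, as it weakens the bound on each of the \<open>n\<close> multiples by 15, so that
  \<open>s = q^(-n)\<close> below.
\<close>

function nonmult_gf :: "(nat \<Rightarrow> 'a::comm_ring_1) \<Rightarrow> 'a \<Rightarrow> nat \<Rightarrow> nat \<Rightarrow> 'a" where
  "nonmult_gf w s L B =
    (if B \<le> L + 6 then 1
     else nonmult_gf w s L (B - 1) +
       (if B mod 15 \<in> {7, 11, 13, 14}
        then (if B = L + 7 then s else 1) * w B * nonmult_gf w s L (B - 15)
        else if B mod 15 \<in> {3, 5, 6, 9, 10, 12} \<and> L + 15 < B then w B * nonmult_gf w s L (B - 16)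
        else 0))"
  by pat_completeness auto
termination
  by (relation "measure (\<lambda>(w, s, L, B). B)") (simp_all del: insert_iff)

declare nonmult_gf.simps [simp del]

text \<open>The letters present are the binary digits of 15 - r, with \<open>a, b, c, d\<close>
  standing for 8, 4, 2, 1: for example r = 3 gives 12 = 8 + 4 and hence \<open>a*b\<close>.
  Admissible non-multiples have one or two letters.\<close>

definition colour :: "'a::comm_ring_1 \<Rightarrow> 'a \<Rightarrow> 'a \<Rightarrow> 'a \<Rightarrow> nat \<Rightarrow> 'a" where
  "colour a b c d r = (if r \<in> {3, 5, 6, 7} then a else 1) * (if r \<in> {3, 9, 10, 11} then b else 1)
     * (if r \<in> {5, 9, 12, 13} then c else 1) * (if r \<in> {6, 10, 12, 14} then d else 1)"

text \<open>For r = B mod 15 one has B = 15 (B div 15 + 1) - (15 - r). The letters supply x^-(15 -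
  r), so with \<open>q = x^15\<close> an admissible part B gets weight x^B.\<close>

definition weight :: "'a::comm_ring_1 \<Rightarrow> 'a \<Rightarrow> 'a \<Rightarrow> 'a \<Rightarrow> 'a \<Rightarrow> nat \<Rightarrow> 'a" where
  "weight q a b c d B = colour a b c d (B mod 15) * q ^ Suc (B div 15)"

text \<open>
  The generating function of \<open>n\<close> multiples of 15, at least 45 and with gaps at least 60. In
  accordance with \<open>weight\<close>, the part \<open>15 k\<close> has weight \<open>e q^(k+1)\<close>.
\<close>

definition mult_gf :: "'a::field \<Rightarrow> 'a \<Rightarrow> nat \<Rightarrow> 'a" where
  "mult_gf q e n = e ^ n * q ^ (2 * n\<^sup>2 + 2 * n) / qprod q n"

text \<open>This is \<open>T(M)\<close>. The number n of multiples is cut off where the shift 30 n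
  exceeds the bound 15 M; by the estimate in \<open>pgf_stable\<close> the terms left out have order
  at least M.\<close>

definition partial_gf :: "'a::field \<Rightarrow> 'a \<Rightarrow> 'a \<Rightarrow> 'a \<Rightarrow> 'a \<Rightarrow> nat \<Rightarrow> 'a" where
  "partial_gf q a b c d M = (\<Sum>n | 2 * n \<le> M. mult_gf q (a*b*c*d) n
      * nonmult_gf (weight q a b c d) (inverse q ^ n) (30 * n) (15 * M - 1))"

text \<open>
  With this normalisation multiplication by \<open>X\<close> is the operator sending \<open>f\<close> to \<open>q^M f(M-1)\<close>, and
  \<open>F(X) \<mapsto> (X/q) F(X/q)\<close> is the shift \<open>f(M) \<mapsto> f(M-1)\<close>.
\<close>

definition to_fps :: "'a::field \<Rightarrow> (nat \<Rightarrow> 'a) \<Rightarrow> 'a fps" where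
  "to_fps q f = Abs_fps (\<lambda>n. f n * inverse q ^ (n * Suc n div 2))"

lemma triangle_Suc: "Suc n * Suc (Suc n) div 2 = n * Suc n div 2 + Suc n"
proof -
  have "Suc n * Suc (Suc n) = n * Suc n + Suc n * 2"
    by (simp add: algebra_simps)
  then show ?thesis
    by (simp only: div_mult_self1 add.commute zero_neq_numeral not_False_eq_True)
qed

text \<open>Consecutive triangular numbers differ by \<open>Suc m\<close>, so the factor
  \<open>q ^ Suc m\<close> turns the normalisation at \<open>Suc m\<close> into the one at
  \<open>m\<close>.\<close>

lemma to_fps_step:
  fixes q :: "'a::field"
  assumes "q \<noteq> 0" "f 0 = g 0" "\<And>m. f (Suc m) = g (Suc m) + u * q ^ Suc m * k m"
  shows "to_fps q f = to_fps q g + fps_const u * fps_X * to_fps q k"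
proof (rule fps_ext)
  fix n
  show "fps_nth (to_fps q f) n = fps_nth (to_fps q g + fps_const u * fps_X * to_fps q k) n"
  proof (cases n)
    case 0
    then show ?thesis
      using assms(2) by (simp add: to_fps_def mult.assoc)
  next
    case (Suc m)
    have "q ^ Suc m * inverse q ^ (Suc m * Suc (Suc m) div 2) = inverse q ^ (m * Suc m div 2)"
      unfolding triangle_Suc power_add using assms(1)
      by (simp add: field_simps)
    then show ?thesis
      using Suc assms(3)[of m] by (simp add: to_fps_def mult.assoc algebra_simps del: mult_Suc mult_Suc_right)
  qed
qed

text \<open>Without the factor \<open>q ^ Suc m\<close> the normalisation leaves a surplus q^-(m+1),
  supplied by the dilation and the constant \<open>inverse q\<close>.\<close>

lemma to_fps_shift:
  fixes q :: "'a::field"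
  assumes "f 0 = 0" "\<And>m. f (Suc m) = g m"
  shows "to_fps q f = fps_const (inverse q) * fps_X * fps_dilate (inverse q) (to_fps q g)"
proof (rule fps_ext)
  fix n
  show "fps_nth (to_fps q f) n = fps_nth (fps_const (inverse q) * fps_X * fps_dilate (inverse q) (to_fps q g)) n"
    by (cases n) (simp_all add: to_fps_def mult.assoc assms triangle_Suc power_add
        del: mult_Suc mult_Suc_right)
qed

lemma to_fps_add: "to_fps q (\<lambda>n. f n + g n) = to_fps q f + to_fps q g"
  by (rule fps_ext) (simp add: to_fps_def algebra_simps)

text \<open>Records the empty list of non-multiples: with n multiples it enters at the index M = 2
  n, where 15 M equals the shift 30 n.\<close>

definition even_seq :: "(nat \<Rightarrow> 'a::zero) \<Rightarrow> nat \<Rightarrow> 'a" where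
  "even_seq f M = (if even M then f (M div 2) else 0)"

text \<open>At index 2 n the normalisation is q^-(n (2 n + 1)), which reduces the power 2 n^2 + 2 n
  in \<open>mult_gf\<close> to n. The first variant arises from the shifted part 7, the second from
  the other primary parts, the third from the last term of \<open>gf_equation_step\<close>.\<close>

lemma to_fps_mult_gf:
  fixes q :: "'a::field"
  assumes q: "q \<noteq> 0"
  shows "to_fps q (even_seq (\<lambda>n. mult_gf q e n * inverse q ^ n)) = qexp q e"
    and "to_fps q (even_seq (mult_gf q e)) = qexp q (e * q)"
    and "to_fps q (even_seq (\<lambda>n. q ^ n * mult_gf q e n)) = qexp q (e * q\<^sup>2)"
proof -
  have tri: "n * Suc (2 * n) = 2 * n\<^sup>2 + n" for n :: nat
    by (simp add: power2_eq_square)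
  have inv: "q ^ k * inverse q ^ k = 1" for k
    using q by (simp flip: power_mult_distrib)
  have m: "mult_gf q e n * inverse q ^ (n * Suc (2 * n)) = (e * q) ^ n / qprod q n" for n
  proof -
    have "2 * n\<^sup>2 + 2 * n = n + (2 * n\<^sup>2 + n)"
      by simp
    then have "mult_gf q e n * inverse q ^ (n * Suc (2 * n))
        = e ^ n * q ^ n / qprod q n * (q ^ (2 * n\<^sup>2 + n) * inverse q ^ (2 * n\<^sup>2 + n))"
      unfolding tri mult_gf_def by (simp only: power_add times_divide_eq_left mult.assoc)
    then show ?thesis
      by (simp only: inv mult_1_right power_mult_distrib)
  qed
  show "to_fps q (even_seq (mult_gf q e)) = qexp q (e * q)"
    by (rule fps_ext) (auto simp: to_fps_def even_seq_def qexp_def m elim!: evenE simp del: mult_Suc_right)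
  have "mult_gf q e n * inverse q ^ n * inverse q ^ (n * Suc (2 * n))
      = (mult_gf q e n * inverse q ^ (n * Suc (2 * n))) * inverse q ^ n" for n
    by (simp only: mult_ac)
  also have "\<dots> n = e ^ n / qprod q n" for n
    unfolding m using inv[of n] by (simp only: power_mult_distrib times_divide_eq_left mult.assoc mult_1_right)
  finally have m1: "mult_gf q e n * inverse q ^ n * inverse q ^ (n * Suc (2 * n)) = e ^ n / qprod q n" for n .
  show "to_fps q (even_seq (\<lambda>n. mult_gf q e n * inverse q ^ n)) = qexp q e"
    by (rule fps_ext) (auto simp: to_fps_def even_seq_def qexp_def m1 elim!: evenE simp del: mult_Suc_right)
  have m2: "q ^ n * mult_gf q e n * inverse q ^ (n * Suc (2 * n)) = (e * q\<^sup>2) ^ n / qprod q n" for n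
    unfolding mult.assoc m by (simp only: power_mult_distrib power2_eq_square times_divide_eq_right mult_ac)
  show "to_fps q (even_seq (\<lambda>n. q ^ n * mult_gf q e n)) = qexp q (e * q\<^sup>2)"
    by (rule fps_ext) (auto simp: to_fps_def even_seq_def qexp_def m2 elim!: evenE simp del: mult_Suc_right)
qed

text \<open>
  The value at index \<open>M\<close> bounds the parts by the part with residue \<open>r\<close> in the \<open>M\<close>-th block of 15
  numbers. The empty list is counted separately, so the sequence vanishes up to \<open>2 n\<close>.
\<close>

definition nonmult_seq :: "(nat \<Rightarrow> 'a::comm_ring_1) \<Rightarrow> 'a \<Rightarrow> nat \<Rightarrow> nat \<Rightarrow> nat \<Rightarrow> 'a" where
  "nonmult_seq w s n r M = (if 2 * n < M then nonmult_gf w s (30 * n) (15 * (M - 1) + r) else 0)"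

section \<open>Recurrences from residue to residue\<close>

lemma nonmult_gf_base: "B \<le> L + 6 \<Longrightarrow> nonmult_gf w s L B = 1"
  by (simp add: nonmult_gf.simps)

lemma nonmult_gf_skip:
  assumes "B mod 15 \<in> {0, 1, 2, 4, 8}"
  shows "nonmult_gf w s L B = nonmult_gf w s L (B - 1)"
proof (cases "B \<le> L + 6")
  case False
  have "B mod 15 \<notin> {7, 11, 13, 14}" "B mod 15 \<notin> {3, 5, 6, 9, 10, 12}"
    using assms by (elim insertE emptyE; simp)+
  then show ?thesis
    using False by (simp only: nonmult_gf.simps[of w s L B] if_False simp_thms add_0_right)
qed (simp add: nonmult_gf_base)

lemma nonmult_gf_primary:
  assumes "B mod 15 \<in> {7, 11, 13, 14}" and "L + 6 < B"
  shows "nonmult_gf w s L B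
    = nonmult_gf w s L (B - 1) + (if B = L + 7 then s else 1) * w B * nonmult_gf w s L (B - 15)"
  using assms by (simp only: nonmult_gf.simps[of w s L B] if_False if_True not_le[symmetric] simp_thms)

lemma nonmult_gf_secondary:
  assumes "B mod 15 \<in> {3, 5, 6, 9, 10, 12}"
  shows "nonmult_gf w s L B
    = nonmult_gf w s L (B - 1) + (if L + 15 < B then w B * nonmult_gf w s L (B - 16) else 0)"
proof (cases "B \<le> L + 6")
  case False
  have "B mod 15 \<notin> {7, 11, 13, 14}"
    using assms by (elim insertE emptyE; simp)
  then show ?thesis
    using False assms by (simp only: nonmult_gf.simps[of w s L B] if_False simp_thms)
qed (simp add: nonmult_gf_base)

lemma nonmult_seq_0 [simp]: "nonmult_seq w s n r 0 = 0"
  by (simp add: nonmult_seq_def)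

lemma nonmult_seq_Suc: "nonmult_seq w s n r (Suc m) = (if 2 * n \<le> m then nonmult_gf w s (30 * n) (15 * m + r) else 0)"
  by (simp add: nonmult_seq_def)

text \<open>\<open>r0\<close> is the last admissible residue before \<open>r\<close>. Below a part
  15 m + r that is not coprime to 15 the next part is at most 15 (m - 1) + r - 1, so the bound falls
  to \<open>r0\<close> in the previous block.\<close>

lemma nonmult_seq_secondary:
  assumes "(r0, r) \<in> {(3, 5), (5, 6), (7, 9), (9, 10), (11, 12)}"
  shows "nonmult_seq w s n r (Suc m) = nonmult_seq w s n r0 (Suc m) + w (15 * m + r) * nonmult_seq w s n r0 m"
proof (cases "2 * n \<le> m")
  case True
  have skip: "nonmult_gf w s (30 * n) (15 * k + r - 1) = nonmult_gf w s (30 * n) (15 * k + r0)" for k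
  proof (cases "r0 = r - 1")
    case False
    with assms have "r0 = 3 \<and> r = 5 \<or> r0 = 7 \<and> r = 9"
      by auto
    then show ?thesis
      using nonmult_gf_skip[of "15 * k + 4" w s "30 * n"] nonmult_gf_skip[of "15 * k + 8" w s "30 * n"]
      by (elim disjE) (simp_all add: add.commute)
  qed (use assms in \<open>auto simp: add.commute\<close>)
  have "r \<in> {5, 6, 9, 10, 12}"
    using assms by auto
  then have r: "(15 * m + r) mod 15 \<in> {3, 5, 6, 9, 10, 12}" "5 \<le> r" "r \<le> 12"
    by (elim insertE emptyE; simp)+
  have "nonmult_gf w s (30 * n) (15 * m + r) = nonmult_gf w s (30 * n) (15 * m + r0)
      + (if 30 * n + 15 < 15 * m + r then w (15 * m + r) * nonmult_gf w s (30 * n) (15 * m + r - 16) else 0)"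
    unfolding skip[symmetric] by (rule nonmult_gf_secondary[OF r(1)])
  moreover have "(30 * n + 15 < 15 * m + r) = (2 * n < m)"
    using r(2,3) True by linarith
  moreover have "nonmult_gf w s (30 * n) (15 * m + r - 16) = nonmult_seq w s n r0 m" if "2 * n < m"
  proof -
    have "15 * m + r - 16 = 15 * (m - 1) + r - 1"
      using that r(2) by (cases m) auto
    then show ?thesis
      using that skip[of "m - 1"] by (simp only: nonmult_seq_def if_True)
  qed
  moreover have "nonmult_seq w s n r0 m = 0" if "\<not> 2 * n < m"
    using that by (simp only: nonmult_seq_def if_False)
  ultimately show ?thesis
    using True unfolding nonmult_seq_Suc by (cases "2 * n < m") (simp_all only: if_True if_False mult_zero_right simp_thms)
qed (simp add: nonmult_seq_Suc nonmult_seq_def)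

text \<open>A part coprime to 15 allows a gap of exactly 15, so the same residue reappears in the
  previous block. For m = 2 n only the empty list remains below it; \<open>nonmult_seq\<close> omits
  that list, hence the extra term, weighted by \<open>s\<close> for the part 30 n + 7.\<close>

lemma nonmult_seq_primary:
  assumes "r \<in> {7, 11, 13, 14}"
  shows "nonmult_seq w s n r (Suc m) = nonmult_seq w s n (r - 1) (Suc m) + w (15 * m + r)
    * (nonmult_seq w s n r m + (if m = 2 * n then if r = 7 then s else 1 else 0))"
proof (cases "2 * n \<le> m")
  case True
  have "nonmult_gf w s (30 * n) (15 * m + r) = nonmult_gf w s (30 * n) (15 * m + r - 1)
      + (if 15 * m + r = 30 * n + 7 then s else 1) * w (15 * m + r) * nonmult_gf w s (30 * n) (15 * m + r - 15)"
    using assms True by (intro nonmult_gf_primary) auto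
  moreover have "(15 * m + r = 30 * n + 7) = (m = 2 * n \<and> r = 7)"
    using assms by (elim insertE emptyE; hypsubst; presburger)
  moreover have "15 * m + r - 15 = 15 * (m - 1) + r" if "2 * n < m"
    using that by simp
  moreover have "nonmult_gf w s (30 * n) (15 * m + r - 15) = 1" if "m = 2 * n"
    using that assms by (intro nonmult_gf_base) auto
  moreover have "15 * m + (r - 1) = 15 * m + r - 1"
    using assms by auto
  ultimately show ?thesis
    using True by (cases "m = 2 * n") (simp_all add: nonmult_seq_Suc nonmult_seq_def)
qed (simp add: nonmult_seq_Suc nonmult_seq_def)

text \<open>Residue 3 opens a block. Without the part 15 m + 3 the bound falls to residue 14 one
  block earlier; with it, the gap of 16 leads to 15 (m - 1) + 2, that is, to residue 14 two blocks
  earlier.\<close>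

lemma nonmult_seq_3:
  "nonmult_seq w s n 3 (Suc m) = nonmult_seq w s n 14 m + (if m = 2 * n then 1 else 0)
    + w (15 * m + 3) * (case m of 0 \<Rightarrow> 0 | Suc k \<Rightarrow> nonmult_seq w s n 14 k + (if k = 2 * n then 1 else 0))"
proof (cases "2 * n < m")
  case True
  then obtain k where m: "m = Suc k" "2 * n \<le> k"
    by (cases m) auto
  have skip: "nonmult_gf w s (30 * n) (15 * Suc i + 2) = nonmult_gf w s (30 * n) (15 * i + 14)" for i
    using nonmult_gf_skip[of "15 * i + 17" w s "30 * n"] nonmult_gf_skip[of "15 * i + 16" w s "30 * n"]
      nonmult_gf_skip[of "15 * i + 15" w s "30 * n"] by (simp add: add.commute)
  have "nonmult_gf w s (30 * n) (15 * m + 3) = nonmult_gf w s (30 * n) (15 * m + 2)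
      + w (15 * m + 3) * nonmult_gf w s (30 * n) (15 * k + 2)"
    using nonmult_gf_secondary[of "15 * m + 3" w s "30 * n"] m by simp
  also have "nonmult_gf w s (30 * n) (15 * k + 2) = nonmult_seq w s n 14 k + (if k = 2 * n then 1 else 0)"
  proof (cases "k = 2 * n")
    case True
    then show ?thesis by (simp add: nonmult_gf_base nonmult_seq_def)
  next
    case False
    with m obtain i where "k = Suc i" "2 * n \<le> i" by (cases k) auto
    then show ?thesis using skip[of i] by (simp add: nonmult_seq_Suc)
  qed
  finally show ?thesis
    using m skip[of k] by (simp add: nonmult_seq_Suc)
next
  case False
  then show ?thesis
    by (auto simp: nonmult_seq_Suc nonmult_gf_base nonmult_seq_def split: nat.splits)
qed

lemma weight_eq: "r < 15 \<Longrightarrow> weight q a b c d (15 * m + r) = colour a b c d r * q ^ Suc m"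
  by (simp add: weight_def)

section \<open>Summation over the number of multiples\<close>

definition total_seq :: "'a::field \<Rightarrow> 'a \<Rightarrow> 'a \<Rightarrow> 'a \<Rightarrow> 'a \<Rightarrow> nat \<Rightarrow> nat \<Rightarrow> 'a" where
  "total_seq q a b c d r M = (\<Sum>n\<le>M. mult_gf q (a*b*c*d) n * nonmult_seq (weight q a b c d) (inverse q ^ n) n r M)"

text \<open>Terms with 2 n >= M vanish, so all sequences in a recurrence can be summed over one
  common range.\<close>

lemma total_seq_extend:
  "M \<le> N \<Longrightarrow> total_seq q a b c d r M
    = (\<Sum>n\<le>N. mult_gf q (a*b*c*d) n * nonmult_seq (weight q a b c d) (inverse q ^ n) n r M)"
  unfolding total_seq_def by (rule sum.mono_neutral_left) (auto simp: nonmult_seq_def)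

lemma even_seq_extend:
  fixes f :: "nat \<Rightarrow> 'a::semiring_1"
  shows "m \<le> N \<Longrightarrow> even_seq f m = (\<Sum>n\<le>N. f n * (if m = 2 * n then 1 else 0))"
proof (cases "even m")
  case True
  assume "m \<le> N"
  obtain k where k: "m = 2 * k" using True by blast
  have "(\<Sum>n\<le>N. f n * (if m = 2 * n then 1 else 0)) = (\<Sum>n\<le>N. if n = k then f n else 0)"
    by (rule sum.cong) (auto simp: k)
  also have "\<dots> = f k"
    using \<open>m \<le> N\<close> k by simp
  finally show ?thesis by (simp add: k even_seq_def)
next
  case False
  then have "(\<Sum>n\<le>N. f n * (if m = 2 * n then 1 else 0)) = 0"
    by (intro sum.neutral) auto
  with False show ?thesis by (simp add: even_seq_def)
qed

text \<open>\<open>nonmult_seq\<close> starts above M = 2 n, while \<open>partial_gf\<close>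
  includes M = 2 n, where the empty list contributes 1.\<close>

lemma partial_gf_eq: "partial_gf q a b c d M = total_seq q a b c d 14 M + even_seq (mult_gf q (a*b*c*d)) M"
proof -
  have "partial_gf q a b c d M = (\<Sum>n\<le>M. if 2 * n \<le> M then mult_gf q (a*b*c*d) n
      * nonmult_gf (weight q a b c d) (inverse q ^ n) (30 * n) (15 * M - 1) else 0)"
    unfolding partial_gf_def by (simp flip: sum.inter_filter) (rule sum.cong, auto)
  also have "\<dots> = (\<Sum>n\<le>M. mult_gf q (a*b*c*d) n * nonmult_seq (weight q a b c d) (inverse q ^ n) n 14 M
      + mult_gf q (a*b*c*d) n * (if M = 2 * n then 1 else 0))"
  proof (rule sum.cong[OF refl])
    fix n
    have "15 * (M - 1) + 14 = 15 * M - 1" if "M > 0" using that by simp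
    moreover have "nonmult_gf (weight q a b c d) (inverse q ^ n) (30 * n) (15 * M - 1) = 1" if "M = 2 * n"
      using that by (intro nonmult_gf_base) auto
    ultimately show "(if 2 * n \<le> M then mult_gf q (a*b*c*d) n
      * nonmult_gf (weight q a b c d) (inverse q ^ n) (30 * n) (15 * M - 1) else 0)
      = mult_gf q (a*b*c*d) n * nonmult_seq (weight q a b c d) (inverse q ^ n) n 14 M
      + mult_gf q (a*b*c*d) n * (if M = 2 * n then 1 else 0)"
      by (cases "2 * n < M") (auto simp: nonmult_seq_def)
  qed
  finally show ?thesis
    by (simp add: sum.distrib total_seq_def even_seq_extend[of M M])
qed

lemma total_seq_0 [simp]: "total_seq q a b c d r 0 = 0"
  by (simp add: total_seq_def)

lemma total_seq_secondary:
  assumes "(r0, r) \<in> {(3, 5), (5, 6), (7, 9), (9, 10), (11, 12)}"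
  shows "total_seq q a b c d r (Suc m) = total_seq q a b c d r0 (Suc m) + colour a b c d r * q ^ Suc m * total_seq q a b c d r0 m"
proof -
  have "r < 15" using assms by auto
  then show ?thesis
    unfolding total_seq_extend[OF le_SucI[OF order.refl[of m]]]
    unfolding total_seq_def nonmult_seq_secondary[OF assms] weight_eq[OF \<open>r < 15\<close>]
    by (simp only: sum.distrib sum_distrib_left distrib_left mult_ac)
qed

lemma total_seq_primary:
  assumes "r \<in> {7, 11, 13, 14}"
  shows "total_seq q a b c d r (Suc m) = total_seq q a b c d (r - 1) (Suc m) + colour a b c d r * q ^ Suc m
    * (total_seq q a b c d r m + even_seq (\<lambda>n. mult_gf q (a*b*c*d) n * (if r = 7 then inverse q ^ n else 1)) m)"
proof -
  have "r < 15" using assms by auto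
  have *: "(if m = 2 * n then if r = 7 then u else 1 else 0) = (if r = 7 then u else 1) * (if m = 2 * n then 1 else 0)" for n :: nat and u :: 'a
    by simp
  show ?thesis
    unfolding total_seq_extend[OF le_SucI[OF order.refl[of m]]] even_seq_extend[OF le_SucI[OF order.refl[of m]]]
    unfolding total_seq_def nonmult_seq_primary[OF assms] weight_eq[OF \<open>r < 15\<close>] *
    by (simp only: sum.distrib sum_distrib_left distrib_left mult_ac)
qed

text \<open>Residues 0, 1, 2 carry no parts, so residue 3 refers back to complete blocks; this
  closes the system of recurrences in terms of \<open>partial_gf\<close>.\<close>

lemma total_seq_3:
  "total_seq q a b c d 3 (Suc m) = partial_gf q a b c d m
    + colour a b c d 3 * q ^ Suc m * (case m of 0 \<Rightarrow> 0 | Suc k \<Rightarrow> partial_gf q a b c d k)"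
proof (cases m)
  case 0
  then show ?thesis
    unfolding partial_gf_eq total_seq_extend[OF le_SucI[OF order.refl[of m]]] even_seq_extend[OF le_SucI[OF order.refl[of m]]]
    unfolding total_seq_def nonmult_seq_3
    by (simp add: sum.distrib distrib_left)
next
  case (Suc k)
  have w3: "weight q a b c d (15 * m + 3) = colour a b c d 3 * q ^ Suc m"
    by (rule weight_eq) simp
  have "total_seq q a b c d 3 (Suc m) = (\<Sum>n\<le>Suc m. mult_gf q (a*b*c*d) n *
     (nonmult_seq (weight q a b c d) (inverse q ^ n) n 14 m + (if m = 2 * n then 1 else 0)
      + colour a b c d 3 * q ^ Suc m * (nonmult_seq (weight q a b c d) (inverse q ^ n) n 14 k + (if k = 2 * n then 1 else 0))))"
    unfolding total_seq_def nonmult_seq_3 w3 by (simp only: Suc nat.case)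
  also have "\<dots> = partial_gf q a b c d m + colour a b c d 3 * q ^ Suc m * partial_gf q a b c d k"
  proof -
    have "m \<le> Suc m" "k \<le> Suc m" using Suc by auto
    then show ?thesis
      unfolding partial_gf_eq total_seq_extend[OF \<open>m \<le> Suc m\<close>] total_seq_extend[OF \<open>k \<le> Suc m\<close>]
        even_seq_extend[OF \<open>m \<le> Suc m\<close>] even_seq_extend[OF \<open>k \<le> Suc m\<close>]
      by (simp only: sum.distrib sum_distrib_left distrib_left mult_ac)
  qed
  finally show ?thesis by (simp add: Suc)
qed

text \<open>\<open>t\<close>r is the series with parts bounded by residue r, \<open>Y\<close> is
  \<open>(X/q) F(X/q)\<close> and \<open>E\<close> is \<open>qexp\<close>. Each two-letter residue
  multiplies by a factor such as \<open>1 + a*b*X\<close>; each one-letter residue divides by a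
  factor such as \<open>1 - a*X\<close> after adding a source.\<close>

lemma colour_combination:
  fixes X a b c d Y E t3 t5 t6 t7 t9 t10 t11 t12 t13 t14 :: "'a::idom"
  assumes "t3 = Y + a*b*X*Y" "t5 = t3 + a*c*X*t3" "t6 = t5 + a*d*X*t5" "t7 = t6 + a*X*(t7 + E)"
    "t9 = t7 + b*c*X*t7" "t10 = t9 + b*d*X*t9" "t11 = t10 + b*X*(t11 + (1 - a*b*c*d*X^2) * E)"
    "t12 = t11 + c*d*X*t11" "t13 = t12 + c*X*(t13 + (1 - a*b*c*d*X^2) * E)"
    "t14 = t13 + d*X*(t14 + (1 - a*b*c*d*X^2) * E)"
  shows "(1 - a*X) * (1 - b*X) * (1 - c*X) * (1 - d*X) * (t14 + (1 - a*b*c*d*X^2) * E) =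
    (1 + a*b*X) * (1 + a*c*X) * (1 + a*d*X) * (1 + b*c*X) * (1 + b*d*X) * (1 + c*d*X) * Y
      + source X a b c d * E"
proof -
  define V where "V = (1 - a*b*c*d*X^2) * E"
  have t6: "t6 = (1 + a*b*X) * (1 + a*c*X) * (1 + a*d*X) * Y"
    unfolding assms(1-3) by algebra
  have t7: "(1 - a*X) * t7 = t6 + a*X*E"
    using assms(4) by algebra
  have t11: "(1 - b*X) * t11 = (1 + b*c*X) * (1 + b*d*X) * t7 + b*X*V"
    using assms(5-7) unfolding V_def[symmetric] by algebra
  have t14: "(1 - c*X) * (1 - d*X) * (t14 + V) = (1 + c*d*X) * t11 + V"
    using assms(8-10) unfolding V_def[symmetric] by algebra
  have "(1 - a*X) * (1 - b*X) * (1 - c*X) * (1 - d*X) * (t14 + V)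
      = (1 - a*X) * ((1 + c*d*X) * ((1 - b*X) * t11) + (1 - b*X) * V)"
    using t14 by algebra
  \<comment> \<open>The terms in \<open>V\<close> combine by
    \<open>(1 + c*d*X) * b*X + (1 - b*X) = 1 + b*c*d*X^2\<close>.\<close>
  also have "\<dots> = (1 + c*d*X) * (1 + b*c*X) * (1 + b*d*X) * ((1 - a*X) * t7) + (1 - a*X) * (1 + b*c*d*X^2) * V"
    unfolding t11 by algebra
  also have "\<dots> = (1 + a*b*X) * (1 + a*c*X) * (1 + a*d*X) * (1 + b*c*X) * (1 + b*d*X) * (1 + c*d*X) * Y
      + source X a b c d * E"
    unfolding t7 t6 V_def source_def by algebra
  finally show ?thesis
    unfolding V_def .
qed

theorem partial_gf_equation:
  fixes q :: "'a::field"
  assumes q: "\<And>n. n > 0 \<Longrightarrow> q ^ n \<noteq> 1" "q \<noteq> 0"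
  shows "gf_equation q a b c d (to_fps q (partial_gf q a b c d))"
proof -
  let ?t = "\<lambda>r. to_fps q (total_seq q a b c d r)"
  let ?Y = "fps_const (inverse q) * fps_X * fps_dilate (inverse q) (to_fps q (partial_gf q a b c d))"
  define e where "e = a*b*c*d"
  define A B C D where "A = fps_const a" and "B = fps_const b" and "C = fps_const c" and "D = fps_const d"
  have e: "fps_const e = A*B*C*D"
    by (simp add: A_def B_def C_def D_def e_def)
  \<comment> \<open>\<open>sh\<close> is T(M - 1). It serves as both sequences in
    \<open>to_fps_step\<close> for residue 3, since including that part goes back one block
    further.\<close>
  define sh where "sh M = (case M of 0 \<Rightarrow> 0 | Suc k \<Rightarrow> partial_gf q a b c d k)" for M
  have sh: "to_fps q sh = ?Y"
    by (rule to_fps_shift) (simp_all add: sh_def)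
  have col: "colour a b c d 3 = a*b" "colour a b c d 5 = a*c" "colour a b c d 6 = a*d" "colour a b c d 7 = a"
    "colour a b c d 9 = b*c" "colour a b c d 10 = b*d" "colour a b c d 11 = b" "colour a b c d 12 = c*d"
    "colour a b c d 13 = c" "colour a b c d 14 = d"
    by (simp_all add: colour_def)
  have sec: "?t r = ?t r0 + fps_const (colour a b c d r) * fps_X * ?t r0"
    if "(r0, r) \<in> {(3, 5), (5, 6), (7, 9), (9, 10), (11, 12)}" for r0 r
    by (rule to_fps_step[OF q(2)]) (simp_all only: total_seq_0 total_seq_secondary[OF that])
  have prim: "?t r = ?t (r - 1) + fps_const (colour a b c d r) * fps_X *
      (?t r + to_fps q (even_seq (\<lambda>n. mult_gf q e n * (if r = 7 then inverse q ^ n else 1))))"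
    if "r \<in> {7, 11, 13, 14}" for r
    unfolding to_fps_add[symmetric] e_def
    by (rule to_fps_step[OF q(2)]) (simp_all only: total_seq_0 total_seq_primary[OF that])
  have q1: "to_fps q (even_seq (mult_gf q e)) = (1 - A*B*C*D*fps_X^2) * qexp q e"
    using qexp_mult[OF q(1), of e] unfolding to_fps_mult_gf(2)[OF q(2)] e .
  have t3: "?t 3 = ?Y + A*B*fps_X*?Y"
    using to_fps_step[OF q(2), of "total_seq q a b c d 3" sh "a*b" sh]
    by (simp add: total_seq_3 col sh sh_def A_def B_def)
  have t5: "?t 5 = ?t 3 + A*C*fps_X * ?t 3" using sec[of 3 5] by (simp add: col A_def C_def)
  have t6: "?t 6 = ?t 5 + A*D*fps_X * ?t 5" using sec[of 5 6] by (simp add: col A_def D_def)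
  have t7: "?t 7 = ?t 6 + A*fps_X * (?t 7 + qexp q e)"
    using prim[of 7] by (simp add: col A_def to_fps_mult_gf(1)[OF q(2)])
  have t9: "?t 9 = ?t 7 + B*C*fps_X * ?t 7" using sec[of 7 9] by (simp add: col B_def C_def)
  have t10: "?t 10 = ?t 9 + B*D*fps_X * ?t 9" using sec[of 9 10] by (simp add: col B_def D_def)
  have t11: "?t 11 = ?t 10 + B*fps_X * (?t 11 + (1 - A*B*C*D*fps_X^2) * qexp q e)"
    using prim[of 11] unfolding q1[symmetric] by (simp add: col B_def)
  have t12: "?t 12 = ?t 11 + C*D*fps_X * ?t 11" using sec[of 11 12] by (simp add: col C_def D_def)
  have t13: "?t 13 = ?t 12 + C*fps_X * (?t 13 + (1 - A*B*C*D*fps_X^2) * qexp q e)"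
    using prim[of 13] unfolding q1[symmetric] by (simp add: col C_def)
  have t14: "?t 14 = ?t 13 + D*fps_X * (?t 14 + (1 - A*B*C*D*fps_X^2) * qexp q e)"
    using prim[of 14] unfolding q1[symmetric] by (simp add: col D_def)
  have "to_fps q (partial_gf q a b c d) = ?t 14 + (1 - A*B*C*D*fps_X^2) * qexp q e"
    unfolding q1[symmetric] unfolding to_fps_add[symmetric] e_def
    by (intro arg_cong[of _ _ "to_fps q"] ext partial_gf_eq)
  with colour_combination[OF t3 t5 t6 t7 t9 t10 t11 t12 t13 t14]
  show ?thesis
    unfolding gf_equation_def Let_def A_def[symmetric] B_def[symmetric] C_def[symmetric] D_def[symmetric] e_def[symmetric]
    by simp
qed

section \<open>Orders of Laurent series\<close>

text \<open>Stated through coefficients so that 0 has every order, whereas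
  \<open>fls_subdegree 0 = 0\<close>.\<close>

definition order_ge :: "int \<Rightarrow> rat fls \<Rightarrow> bool" where
  "order_ge m f \<longleftrightarrow> (\<forall>i<m. fls_nth f i = 0)"

text \<open>The monomial x^i with integer exponent; the letters \<open>a, b, c, d\<close> start at
  negative powers of x.\<close>

definition xp :: "int \<Rightarrow> rat fls" where
  "xp i = fls_X_intpow i"

lemma xp_mult: "xp i * xp j = xp (i + j)"
  by (simp only: xp_def fls_X_intpow_times_fls_X_intpow)

lemma xp_0 [simp]: "xp 0 = 1"
  by (simp add: xp_def)

lemma xp_power: "xp i ^ n = xp (int n * i)"
  by (induction n) (auto simp: xp_mult algebra_simps)

lemma xp_nonzero [simp]: "xp i \<noteq> 0"
  by (simp add: xp_def)

lemma inverse_xp: "inverse (xp i) = xp (- i)"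
  by (rule inverse_unique) (simp add: xp_mult)

lemma xp_times_nth: "fls_nth (xp i * f) n = fls_nth f (n - i)"
  by (simp add: xp_def fls_X_intpow_times_conv_shift)

lemma xp_nth: "fls_nth (xp i) n = (if n = i then 1 else 0)"
  by (auto simp: xp_def)

lemma order_ge_xp: "m \<le> i \<Longrightarrow> order_ge m (xp i)"
  by (auto simp: order_ge_def xp_nth)

lemma order_ge_0 [simp]: "order_ge m 0"
  by (simp add: order_ge_def)

lemma order_ge_1: "m \<le> 0 \<Longrightarrow> order_ge m 1"
  using order_ge_xp[of m 0] by simp

lemma order_ge_mono: "order_ge m f \<Longrightarrow> m' \<le> m \<Longrightarrow> order_ge m' f"
  by (auto simp: order_ge_def)

lemma order_ge_add: "order_ge m f \<Longrightarrow> order_ge m g \<Longrightarrow> order_ge m (f + g)"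
  by (simp add: order_ge_def)

lemma order_ge_diff: "order_ge m f \<Longrightarrow> order_ge m g \<Longrightarrow> order_ge m (f - g)"
  by (simp add: order_ge_def)

lemma order_ge_sum: "(\<And>x. x \<in> A \<Longrightarrow> order_ge m (f x)) \<Longrightarrow> order_ge m (sum f A)"
  by (simp add: order_ge_def fls_nth_sum)

lemma order_ge_subdegree: "f \<noteq> 0 \<Longrightarrow> order_ge m f \<longleftrightarrow> m \<le> fls_subdegree f"
  unfolding order_ge_def
  by (meson fls_eq0_below_subdegree fls_subdegree_geI order_less_le_trans)

lemma order_ge_mult: "order_ge m f \<Longrightarrow> order_ge m' g \<Longrightarrow> order_ge (m + m') (f * g)"
  by (cases "f = 0 \<or> g = 0") (auto simp: order_ge_subdegree)

lemma order_ge_mult': "order_ge m f \<Longrightarrow> order_ge m' g \<Longrightarrow> k \<le> m + m' \<Longrightarrow> order_ge k (f * g)"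
  using order_ge_mult order_ge_mono by blast

text \<open>\<open>qprod\<close> is 1 plus terms of positive order, so its subdegree and that of its
  inverse are 0.\<close>

lemma order_ge_inverse_qprod: "order_ge 0 (inverse (qprod (xp 15) n))"
proof -
  have "order_ge 1 (qprod (xp 15) n - 1) \<and> order_ge 0 (qprod (xp 15) n)"
  proof (induction n)
    case (Suc n)
    have eq: "qprod (xp 15) (Suc n) = qprod (xp 15) n - qprod (xp 15) n * xp (15 * int (Suc n))"
      by (simp add: qprod_Suc xp_power algebra_simps del: power_Suc)
    have "order_ge 1 (qprod (xp 15) n * xp (15 * int (Suc n)))"
      by (rule order_ge_mult'[where m = 0 and m' = "15 * int (Suc n)"]) (use Suc in \<open>auto intro: order_ge_xp\<close>)
    then have "order_ge 1 (qprod (xp 15) (Suc n) - 1)"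
      unfolding eq using Suc by (simp add: order_ge_def)
    then show ?case
      using order_ge_add[OF order_ge_mono[of 1 "qprod (xp 15) (Suc n) - 1" 0] order_ge_1[of 0]] by simp
  qed (simp add: order_ge_1)
  then have "fls_nth (qprod (xp 15) n - 1) 0 = 0" and "order_ge 0 (qprod (xp 15) n)"
    by (auto simp: order_ge_def)
  then have "fls_subdegree (qprod (xp 15) n) = 0"
    by (intro fls_subdegree_eqI) (auto simp: order_ge_def)
  then have "fls_subdegree (inverse (qprod (xp 15) n)) = 0"
    by simp
  then show ?thesis
    by (metis order_ge_0 order_ge_subdegree order.refl)
qed

lemma xp_power_neq_1: "n > 0 \<Longrightarrow> xp 15 ^ n \<noteq> 1"
proof
  assume "n > 0" "xp 15 ^ n = 1"
  then have "fls_nth (xp (int n * 15)) 0 = fls_nth (xp 0) 0"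
    by (simp add: xp_power)
  with \<open>n > 0\<close> show False by (simp add: xp_nth)
qed

text \<open>The recurrence treats the letters in a fixed order and singles out \<open>a\<close>
  through the part L + 7; the symmetry emerges only because both sides solve one symmetric equation
  with a unique solution.\<close>

lemma partial_gf_rotate:
  fixes q :: "'a::field"
  assumes q: "\<And>n. n > 0 \<Longrightarrow> q ^ n \<noteq> 1" "q \<noteq> 0"
  shows "partial_gf q a b c d = partial_gf q b c d a"
proof -
  have "gf_equation q b c d a (to_fps q (partial_gf q a b c d))"
    by (rule gf_equation_rotate[THEN iffD1], rule partial_gf_equation) (use q in auto)
  then have "to_fps q (partial_gf q a b c d) = to_fps q (partial_gf q b c d a)"
    by (rule gf_equation_unique, intro partial_gf_equation) (use q in auto)
  then have "fps_nth (to_fps q (partial_gf q a b c d)) M = fps_nth (to_fps q (partial_gf q b c d a)) M" for M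
    by simp
  then show ?thesis
    using q(2) by (intro ext) (simp add: to_fps_def)
qed

section \<open>From series back to sequences, up to high order\<close>

definition from_fps :: "'a::field \<Rightarrow> 'a fps \<Rightarrow> nat \<Rightarrow> 'a" where
  "from_fps q F M = fps_nth F M * q ^ (M * Suc M div 2)"

lemma from_fps_to_fps: "q \<noteq> 0 \<Longrightarrow> from_fps q (to_fps q f) M = f M"
  by (simp add: from_fps_def to_fps_def power_inverse mult.assoc)

lemma from_fps_add: "from_fps q (F + H) M = from_fps q F M + from_fps q H M"
  by (simp add: from_fps_def algebra_simps)

lemma from_fps_diff: "from_fps q (F - H) M = from_fps q F M - from_fps q H M"
  by (simp add: from_fps_def algebra_simps)

lemma from_fps_const: "from_fps q (fps_const u * F) M = u * from_fps q F M"
  by (simp add: from_fps_def algebra_simps)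

lemma from_fps_X:
  "from_fps q (fps_X * F) M = (case M of 0 \<Rightarrow> 0 | Suc m \<Rightarrow> q ^ Suc m * from_fps q F m)"
proof (cases M)
  case (Suc m)
  have "q ^ (Suc m * Suc (Suc m) div 2) = q ^ (m * Suc m div 2) * q ^ Suc m"
    by (simp only: triangle_Suc power_add)
  then show ?thesis
    by (simp add: Suc from_fps_def del: mult_Suc mult_Suc_right power_Suc)
qed (simp add: from_fps_def)

definition order_ge_seq :: "(nat \<Rightarrow> rat fls) \<Rightarrow> bool" where
  "order_ge_seq f \<longleftrightarrow> (\<forall>M. order_ge 0 (f M))"

text \<open>The agreement improves with M, so for convergent sequences it means equality of the
  coefficientwise limits.\<close>

definition fls_close :: "(nat \<Rightarrow> rat fls) \<Rightarrow> (nat \<Rightarrow> rat fls) \<Rightarrow> bool" where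
  "fls_close f g \<longleftrightarrow> (\<forall>M. order_ge (int M) (f M - g M))"

lemma fls_close_trans: "fls_close f g \<Longrightarrow> fls_close g h \<Longrightarrow> fls_close f h"
  unfolding fls_close_def
proof safe
  fix M assume "\<forall>M. order_ge (int M) (f M - g M)" "\<forall>M. order_ge (int M) (g M - h M)"
  then have "order_ge (int M) ((f M - g M) + (g M - h M))"
    by (blast intro: order_ge_add)
  then show "order_ge (int M) (f M - h M)" by simp
qed

text \<open>Multiplication by \<open>X\<close> brings the factor \<open>q ^ M\<close> with
  \<open>q = x^15\<close>, whose order 15 M is at least M.\<close>

lemma fls_close_linear_factor:
  assumes "order_ge_seq (from_fps (xp 15) F)" "order_ge 0 u"
  shows "order_ge_seq (from_fps (xp 15) ((1 + fps_const u * fps_X) * F))"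
    and "fls_close (from_fps (xp 15) ((1 + fps_const u * fps_X) * F)) (from_fps (xp 15) F)"
proof -
  let ?f = "from_fps (xp 15)"
  have eq: "?f ((1 + fps_const u * fps_X) * F) M = ?f F M + u * ?f (fps_X * F) M" for M
    by (simp add: distrib_right from_fps_add from_fps_const mult.assoc)
  have *: "order_ge (int M) (u * ?f (fps_X * F) M)" for M
  proof (cases M)
    case (Suc m)
    have A: "order_ge (int (Suc m)) (xp 15 ^ Suc m * ?f F m)"
      using assms(1) by (intro order_ge_mult'[where m = "int (Suc m)" and m' = 0])
        (auto simp: xp_power order_ge_seq_def simp del: power_Suc intro: order_ge_xp)
    show ?thesis
      unfolding from_fps_X Suc nat.case by (rule order_ge_mult'[OF assms(2) A]) simp
  qed (simp add: from_fps_X)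
  show "order_ge_seq (?f ((1 + fps_const u * fps_X) * F))"
    using assms(1) order_ge_mono[OF *, of 0] unfolding order_ge_seq_def eq by (auto intro: order_ge_add)
  show "fls_close (?f ((1 + fps_const u * fps_X) * F)) (?f F)"
    using * unfolding fls_close_def eq by simp
qed

text \<open>In \<open>gf_equation_step\<close> every linear factor changes the sequence only by
  terms of order M, and so does the \<open>qexp\<close> term; the constant factor
  \<open>1 + d*q\<close> survives.\<close>

lemma partial_gf_step:
  defines "q \<equiv> xp 15"
  assumes "order_ge 0 (a*d*q)" "order_ge 0 (b*d*q)" "order_ge 0 (c*d*q)" "order_ge 0 (d*q)"
    and T: "order_ge_seq (partial_gf q a b c d)" "order_ge_seq (partial_gf q a b c (d*q))"
    and corr: "\<And>n. order_ge (2 * int n) (q ^ n * mult_gf q (a*b*c*d) n)"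
  shows "fls_close (partial_gf q a b c d) (\<lambda>M. (1 + d*q) * partial_gf q a b c (d*q) M)"
proof -
  let ?f = "from_fps q"
  have q: "\<And>n. n > 0 \<Longrightarrow> q ^ n \<noteq> 1" "q \<noteq> 0"
    by (simp_all add: q_def xp_power_neq_1)
  define F F' where "F = to_fps q (partial_gf q a b c d)" and "F' = to_fps q (partial_gf q a b c (d*q))"
  have F: "?f F = partial_gf q a b c d" "?f F' = partial_gf q a b c (d*q)"
    by (simp_all add: F_def F'_def fun_eq_iff from_fps_to_fps[OF q(2)])
  note lin = fls_close_linear_factor[folded q_def]
  define F3 where "F3 = (1 + fps_const (c*d*q) * fps_X) * F"
  define F2 where "F2 = (1 + fps_const (b*d*q) * fps_X) * F3"
  define F1 where "F1 = (1 + fps_const (a*d*q) * fps_X) * F2"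
  define G where "G = (1 + fps_const (- (d*q)) * fps_X) * F'"
  have 3: "order_ge_seq (?f F3)" "fls_close (?f F3) (?f F)"
    unfolding F3_def by (intro lin; use T assms F in simp)+
  have 2: "order_ge_seq (?f F2)" "fls_close (?f F2) (?f F3)"
    unfolding F2_def by (intro lin; use 3 assms in simp)+
  have 1: "fls_close (?f F1) (?f F2)"
    unfolding F1_def by (intro lin; use 2 assms in simp)+
  have neg: "order_ge 0 (- (d*q))"
    using order_ge_diff[OF order_ge_0 assms(5)] by simp
  have 4: "fls_close (?f G) (?f F')"
    unfolding G_def by (intro lin; use T F neg in simp)+
  have F1F: "fls_close (?f F1) (?f F)"
    using fls_close_trans[OF fls_close_trans[OF 1 2(2)] 3(2)] .
  have "gf_equation q a b c d F" "gf_equation q a b c (d*q) F'"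
    unfolding F_def F'_def by (intro partial_gf_equation; use q in auto)+
  then have "(1 + fps_const (a*d*q) * fps_X) * (1 + fps_const (b*d*q) * fps_X) * (1 + fps_const (c*d*q) * fps_X) * F
      = fps_const (1 + d * q) * (1 - fps_const (d*q) * fps_X) * F' - fps_const (d*q) * qexp q (a*b*c*d*q\<^sup>2)"
    by (intro gf_equation_step) (use q in auto)
  moreover have "1 - fps_const (d*q) * fps_X = 1 + fps_const (- (d*q)) * fps_X"
    by (simp flip: fps_const_neg)
  ultimately have "F1 = fps_const (1 + d*q) * G - fps_const (d*q) * qexp q (a*b*c*d*q\<^sup>2)"
    unfolding F1_def F2_def F3_def G_def by (simp only: mult.assoc)
  then have F1: "?f F1 M = (1 + d*q) * ?f G M - d*q * even_seq (\<lambda>n. q ^ n * mult_gf q (a*b*c*d) n) M" for M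
    by (simp only: from_fps_diff from_fps_const to_fps_mult_gf(3)[OF q(2), symmetric] from_fps_to_fps[OF q(2)])
  have "order_ge (int M) (partial_gf q a b c d M - (1 + d*q) * partial_gf q a b c (d*q) M)" for M
  proof -
    \<comment> \<open>For M = 2 n the assumption \<open>corr\<close> gives exactly order M; for odd
      M the term is zero.\<close>
    have 0: "order_ge (int M) (even_seq (\<lambda>n. q ^ n * mult_gf q (a*b*c*d) n) M)"
      using corr[of "M div 2"] by (auto simp: even_seq_def)
    have 5: "order_ge (int M) (d*q * even_seq (\<lambda>n. q ^ n * mult_gf q (a*b*c*d) n) M)"
      by (rule order_ge_mult'[OF assms(5) 0]) simp
    have dq: "order_ge 0 (1 + d*q)"
      by (rule order_ge_add[OF order_ge_1 assms(5)]) simp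
    have "order_ge (int M) (?f G M - ?f F' M)"
      using 4 by (simp add: fls_close_def)
    from order_ge_mult'[OF dq this] have 6: "order_ge (int M) ((1 + d*q) * (?f G M - ?f F' M))"
      by simp
    \<comment> \<open>Inserting the formula \<open>F1\<close> reduces this combination to the
      difference to be estimated.\<close>
    have "order_ge (int M) ((1 + d*q) * (?f G M - ?f F' M) - (?f F1 M - ?f F M)
        - d*q * even_seq (\<lambda>n. q ^ n * mult_gf q (a*b*c*d) n) M)"
      using F1F by (intro order_ge_diff[OF order_ge_diff[OF 6] 5]) (auto simp: fls_close_def)
    then show ?thesis
      unfolding F1 F by (simp add: algebra_simps)
  qed
  then show ?thesis
    unfolding fls_close_def by blast
qed

section \<open>Orders of the generating functions\<close>

lemma nonmult_gf_cases:
  obtains (same) "nonmult_gf w s L B = nonmult_gf w s L (B - 1)"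
  | (primary) B' where "L + 6 < B" "B mod 15 \<in> {7, 11, 13, 14}"
      "nonmult_gf w s L B = nonmult_gf w s L (B - 1) + (if B = L + 7 then s else 1) * w B * nonmult_gf w s L B'" "B' < B"
  | (secondary) B' where "L + 15 < B" "B mod 15 \<in> {3, 5, 6, 9, 10, 12}"
      "nonmult_gf w s L B = nonmult_gf w s L (B - 1) + w B * nonmult_gf w s L B'" "B' < B"
proof (cases "B \<le> L + 6")
  case True
  then show ?thesis by (intro same) (simp add: nonmult_gf_base)
next
  case False
  then have B: "L + 6 < B" "B - 15 < B" "B - 16 < B" by simp_all
  show ?thesis
  proof (cases "B mod 15 \<in> {7, 11, 13, 14}")
    case True
    show ?thesis
      by (rule primary[OF B(1) True nonmult_gf_primary[OF True B(1)] B(2)])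
  next
    case prim: False
    show ?thesis
    proof (cases "B mod 15 \<in> {3, 5, 6, 9, 10, 12} \<and> L + 15 < B")
      case True
      then have sec: "B mod 15 \<in> {3, 5, 6, 9, 10, 12}" "L + 15 < B" by blast+
      show ?thesis
        using nonmult_gf_secondary[OF sec(1), of w s L] sec(2)
        by (intro secondary[OF sec(2,1) _ B(3)]) (simp only: if_True)
    next
      case False
      show ?thesis
        using \<open>\<not> B \<le> L + 6\<close> prim False
        by (intro same) (simp only: nonmult_gf.simps[of w s L B] if_False add_0_right)
    qed
  qed
qed

lemma nonmult_gf_order:
  assumes "\<And>B. L + 6 < B \<Longrightarrow> B mod 15 \<in> {7, 11, 13, 14} \<Longrightarrow> order_ge 0 ((if B = L + 7 then s else 1) * w B)"
    and "\<And>B. L + 15 < B \<Longrightarrow> B mod 15 \<in> {3, 5, 6, 9, 10, 12} \<Longrightarrow> order_ge 0 (w B)"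
  shows "order_ge 0 (nonmult_gf w s L B)"
proof (induction B rule: less_induct)
  case (less B)
  show ?case
  proof (cases "B = 0")
    case False
    then have IH: "order_ge 0 (nonmult_gf w s L (B - 1))"
      by (intro less) simp
    show ?thesis
    proof (cases rule: nonmult_gf_cases[of w s L B])
      case same
      then show ?thesis using IH by simp
    next
      case (primary B')
      have "order_ge 0 ((if B = L + 7 then s else 1) * w B * nonmult_gf w s L B')"
        by (rule order_ge_mult'[OF assms(1)[OF primary(1,2)] less[OF primary(4)]]) simp
      then show ?thesis
        unfolding primary(3) by (intro order_ge_add IH)
    next
      case (secondary B')
      have "order_ge 0 (w B * nonmult_gf w s L B')"
        by (rule order_ge_mult'[OF assms(2)[OF secondary(1,2)] less[OF secondary(4)]]) simp
      then show ?thesis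
        unfolding secondary(3) by (intro order_ge_add IH)
    qed
  qed (simp add: nonmult_gf_base order_ge_1)
qed

text \<open>Raising the bound from \<open>N\<close> to \<open>B\<close> only adds terms containing
  the weight of a part above \<open>N\<close>, and these have order at least
  \<open>K\<close>.\<close>

lemma nonmult_gf_diff_order:
  assumes prim: "\<And>B. N < B \<Longrightarrow> L + 6 < B \<Longrightarrow> B mod 15 \<in> {7, 11, 13, 14} \<Longrightarrow> order_ge K ((if B = L + 7 then s else 1) * w B)"
    and sec: "\<And>B. N < B \<Longrightarrow> L + 15 < B \<Longrightarrow> B mod 15 \<in> {3, 5, 6, 9, 10, 12} \<Longrightarrow> order_ge K (w B)"
    and ord: "\<And>B. order_ge 0 (nonmult_gf w s L B)" and "N \<le> B"
  shows "order_ge K (nonmult_gf w s L B - nonmult_gf w s L N)"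
  using \<open>N \<le> B\<close>
proof (induction B rule: dec_induct)
  case (step B)
  have N: "N < Suc B" using step by simp
  show ?case
  proof (cases rule: nonmult_gf_cases[of w s L "Suc B"])
    case same
    then show ?thesis using step by simp
  next
    case (primary B')
    have "order_ge K ((if Suc B = L + 7 then s else 1) * w (Suc B) * nonmult_gf w s L B')"
      by (rule order_ge_mult'[OF prim[OF N primary(1,2)] ord]) simp
    from order_ge_add[OF step.IH this] show ?thesis
      unfolding primary(3) by (simp only: diff_Suc_1 algebra_simps)
  next
    case (secondary B')
    have "order_ge K (w (Suc B) * nonmult_gf w s L B')"
      by (rule order_ge_mult'[OF sec[OF N secondary(1,2)] ord]) simp
    from order_ge_add[OF step.IH this] show ?thesis
      unfolding secondary(3) by (simp only: diff_Suc_1 algebra_simps)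
  qed
qed simp

section \<open>Specialisation to powers of x\<close>

text \<open>\<open>a = x^-8 q^i\<close> and likewise for the others, so raising an index by one
  multiplies one letter by \<open>q\<close>; all indices 0 give the weights of the original
  problem.\<close>

definition pgf :: "nat \<Rightarrow> nat \<Rightarrow> nat \<Rightarrow> nat \<Rightarrow> nat \<Rightarrow> rat fls" where
  "pgf i j k l = partial_gf (xp 15) (xp (15 * int i - 8)) (xp (15 * int j - 4))
     (xp (15 * int k - 2)) (xp (15 * int l - 1))"

abbreviation xweight :: "nat \<Rightarrow> nat \<Rightarrow> nat \<Rightarrow> nat \<Rightarrow> nat \<Rightarrow> rat fls" where
  "xweight i j k l \<equiv> weight (xp 15) (xp (15 * int i - 8)) (xp (15 * int j - 4))
     (xp (15 * int k - 2)) (xp (15 * int l - 1))"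

lemma colour_xp:
  assumes "r \<in> {3, 5, 6, 7, 9, 10, 11, 12, 13, 14}"
  shows "colour (xp (15 * int i - 8)) (xp (15 * int j - 4)) (xp (15 * int k - 2)) (xp (15 * int l - 1)) r
    = xp (15 * int ((if r \<in> {3, 5, 6, 7} then i else 0) + (if r \<in> {3, 9, 10, 11} then j else 0)
        + (if r \<in> {5, 9, 12, 13} then k else 0) + (if r \<in> {6, 10, 12, 14} then l else 0)) + int r - 15)"
  using assms by (elim insertE emptyE; hypsubst) (simp_all add: colour_def xp_mult algebra_simps)

lemma xweight_xp:
  assumes "B mod 15 \<in> {3, 5, 6, 7, 9, 10, 11, 12, 13, 14}"
  shows "xweight i j k l B = xp (15 * int ((if B mod 15 \<in> {3, 5, 6, 7} then i else 0)
      + (if B mod 15 \<in> {3, 9, 10, 11} then j else 0) + (if B mod 15 \<in> {5, 9, 12, 13} then k else 0)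
      + (if B mod 15 \<in> {6, 10, 12, 14} then l else 0)) + int B)"
proof -
  have "int B = 15 * int (B div 15) + int (B mod 15)"
    by (metis of_nat_add of_nat_mult of_nat_numeral mult_div_mod_eq)
  then have *: "x + int (B mod 15) - 15 + int (Suc (B div 15)) * 15 = x + int B" for x
    by simp
  show ?thesis
    unfolding weight_def colour_xp[OF assms] xp_power xp_mult * ..
qed

text \<open>Every admissible residue contains at least one letter, and each letter contributes at
  least 15 m beyond its exponent at index 0.\<close>

lemma xweight_order:
  assumes "m \<le> i" "m \<le> j" "m \<le> k" "m \<le> l" and B: "B mod 15 \<in> {3, 5, 6, 7, 9, 10, 11, 12, 13, 14}"
  shows "order_ge (int B + 15 * int m) (xweight i j k l B)"
  unfolding xweight_xp[OF B]
proof (rule order_ge_xp)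
  define r where "r = B mod 15"
  show "int B + 15 * int m \<le> 15 * int ((if B mod 15 \<in> {3, 5, 6, 7} then i else 0)
      + (if B mod 15 \<in> {3, 9, 10, 11} then j else 0) + (if B mod 15 \<in> {5, 9, 12, 13} then k else 0)
      + (if B mod 15 \<in> {6, 10, 12, 14} then l else 0)) + int B"
    using assms unfolding r_def[symmetric] by (elim insertE emptyE; hypsubst) simp_all
qed

lemma mult_gf_xp: "mult_gf (xp 15) (xp e) n = xp (int n * e + 30 * int n ^ 2 + 30 * int n) * inverse (qprod (xp 15) n)"
  by (simp add: mult_gf_def xp_power xp_mult divide_inverse algebra_simps power2_eq_square)

lemma xp_colours:
  "xp (15 * int i - 8) * xp (15 * int j - 4) * xp (15 * int k - 2) * xp (15 * int l - 1)
    = xp (15 * int (i + j + k + l) - 15)"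
  by (simp add: xp_mult algebra_simps)

text \<open>Here s is i + j + k + l, as in \<open>xp_colours\<close>; the exponent is n (15 s - 15)
  + 30 n^2 + 30 n.\<close>

lemma mult_gf_order:
  "order_ge (15 * int n * (2 * int n + 1 + int s)) (mult_gf (xp 15) (xp (15 * int s - 15)) n)"
  unfolding mult_gf_xp
  by (rule order_ge_mult'[OF order_ge_xp[OF order.refl] order_ge_inverse_qprod])
    (simp add: algebra_simps power2_eq_square)

context
  fixes i j k l n :: nat
begin

private abbreviation "w \<equiv> xweight i j k l"
private abbreviation "s \<equiv> inverse (xp 15) ^ n"

lemma inverse_flag: "s = xp (- (15 * int n))"
  by (simp add: inverse_xp xp_power mult.commute)

lemma primary_order:
  assumes "B mod 15 \<in> {7, 11, 13, 14}"
  shows "order_ge (int B - (if B = 30 * n + 7 then 15 * int n else 0)) ((if B = 30 * n + 7 then s else 1) * w B)"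
proof -
  have w: "order_ge (int B) (w B)"
    using xweight_order[of 0 i j k l B] assms by auto
  show ?thesis
  proof (cases "B = 30 * n + 7")
    case True
    have "order_ge (- (15 * int n)) s"
      unfolding inverse_flag by (rule order_ge_xp) simp
    from order_ge_mult'[OF this w] True show ?thesis by simp
  qed (use w in simp)
qed

lemma secondary_order:
  assumes "B mod 15 \<in> {3, 5, 6, 9, 10, 12}"
  shows "order_ge (int B) (w B)"
  using xweight_order[of 0 i j k l B] assms by auto

lemma nonmult_xgf_order: "order_ge 0 (nonmult_gf w s (30 * n) B)"
proof (rule nonmult_gf_order)
  fix B :: nat assume "B mod 15 \<in> {7, 11, 13, 14}"
  from primary_order[OF this] show "order_ge 0 ((if B = 30 * n + 7 then s else 1) * w B)"
    by (rule order_ge_mono) simp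
next
  fix B :: nat assume "B mod 15 \<in> {3, 5, 6, 9, 10, 12}"
  from secondary_order[OF this] show "order_ge 0 (w B)"
    by (rule order_ge_mono) simp
qed

lemma nonmult_xgf_stable:
  assumes "M \<le> M'"
  shows "order_ge (int M) (nonmult_gf w s (30 * n) (15 * M' - 1) - nonmult_gf w s (30 * n) (15 * M - 1))"
proof (rule nonmult_gf_diff_order[OF _ _ nonmult_xgf_order])
  fix B assume B: "15 * M - 1 < B" "B mod 15 \<in> {7, 11, 13, 14}"
  \<comment> \<open>Even the flagged part B = 30 n + 7 keeps order 15 n + 7, which exceeds B / 2 and
    hence M, as B >= 15 M.\<close>
  from primary_order[OF this(2)] show "order_ge (int M) ((if B = 30 * n + 7 then s else 1) * w B)"
    by (rule order_ge_mono) (use B(1) in auto)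
next
  fix B assume B: "15 * M - 1 < B" "B mod 15 \<in> {3, 5, 6, 9, 10, 12}"
  from secondary_order[OF this(2)] show "order_ge (int M) (w B)"
    by (rule order_ge_mono) (use B(1) in auto)
qed (use assms in auto)

end

lemma pgf_order: "order_ge 0 (pgf i j k l M)"
proof -
  have "order_ge 0 (mult_gf (xp 15) (xp (15 * int (i + j + k + l) - 15)) n *
      nonmult_gf (xweight i j k l) (inverse (xp 15) ^ n) (30 * n) B)" for n B
    by (rule order_ge_mult'[OF mult_gf_order nonmult_xgf_order]) simp
  then show ?thesis
    unfolding pgf_def partial_gf_def xp_colours by (intro order_ge_sum)
qed

text \<open>Passing to \<open>M'\<close> raises the bounds for the old n, which adds parts from 15 M
  on, and admits new n with 2 n > M, whose \<open>mult_gf\<close> has order at least 15 n.\<close>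

lemma pgf_stable:
  assumes "M \<le> M'"
  shows "order_ge (int M) (pgf i j k l M' - pgf i j k l M)"
proof -
  let ?c = "mult_gf (xp 15) (xp (15 * int (i + j + k + l) - 15))"
  let ?r = "\<lambda>n M. nonmult_gf (xweight i j k l) (inverse (xp 15) ^ n) (30 * n) (15 * M - 1)"
  have "{n. 2 * n \<le> M'} = {n. 2 * n \<le> M} \<union> {n. M < 2 * n \<and> 2 * n \<le> M'}"
    using assms by auto
  moreover have fin: "finite {n. 2 * n \<le> N}" for N :: nat
    by (rule finite_subset[of _ "{..N}"]) auto
  moreover have "finite {n. M < 2 * n \<and> 2 * n \<le> M'}"
    by (rule finite_subset[OF _ fin[of M']]) auto
  ultimately have "(\<Sum>n | 2 * n \<le> M'. ?c n * ?r n M') = (\<Sum>n | 2 * n \<le> M. ?c n * ?r n M')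
      + (\<Sum>n | M < 2 * n \<and> 2 * n \<le> M'. ?c n * ?r n M')"
    by (simp only:) (rule sum.union_disjoint, auto)
  then have eq: "pgf i j k l M' - pgf i j k l M = (\<Sum>n | 2 * n \<le> M. ?c n * (?r n M' - ?r n M))
      + (\<Sum>n | M < 2 * n \<and> 2 * n \<le> M'. ?c n * ?r n M')"
    unfolding pgf_def partial_gf_def xp_colours by (simp add: sum_subtractf right_diff_distrib)
  have "order_ge (int M) (?c n * (?r n M' - ?r n M))" for n
    by (rule order_ge_mult'[OF mult_gf_order nonmult_xgf_stable[OF assms]]) simp
  moreover have "order_ge (int M) (?c n * ?r n M')" if "M < 2 * n" for n
  proof (rule order_ge_mult'[OF mult_gf_order nonmult_xgf_order])
    have "int M \<le> 15 * int n * 1"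
      using that by simp
    also have "\<dots> \<le> 15 * int n * (2 * int n + 1 + int (i + j + k + l))"
      by (rule mult_left_mono) auto
    finally show "int M \<le> 15 * int n * (2 * int n + 1 + int (i + j + k + l)) + 0" by simp
  qed
  ultimately show ?thesis
    unfolding eq by (intro order_ge_add order_ge_sum) auto
qed

text \<open>With all indices equal to m every part, multiple of 15 or not, raises the order by at
  least 15 m, so up to that order only the empty pair with contribution 1 remains.\<close>

lemma pgf_diagonal: "order_ge (15 * int m) (pgf m m m m M - 1)"
proof -
  let ?c = "mult_gf (xp 15) (xp (15 * int (m + m + m + m) - 15))"
  let ?r = "\<lambda>n. nonmult_gf (xweight m m m m) (inverse (xp 15) ^ n) (30 * n) (15 * M - 1)"
  have fin: "finite {n. 2 * n \<le> N}" for N :: nat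
    by (rule finite_subset[of _ "{..N}"]) auto
  have "(\<Sum>n | 2 * n \<le> M. ?c n * ?r n) = ?c 0 * ?r 0 + (\<Sum>n \<in> {n. 2 * n \<le> M} - {0}. ?c n * ?r n)"
    by (rule sum.remove) (simp_all add: fin)
  then have eq: "pgf m m m m M - 1 = (?r 0 - nonmult_gf (xweight m m m m) (inverse (xp 15) ^ 0) (30 * 0) 0)
      + (\<Sum>n \<in> {n. 2 * n \<le> M} - {0}. ?c n * ?r n)"
    unfolding pgf_def partial_gf_def xp_colours by (simp add: mult_gf_def nonmult_gf_base)
  have "order_ge (15 * int m) (?r 0 - nonmult_gf (xweight m m m m) (inverse (xp 15) ^ 0) (30 * 0) 0)"
  proof (rule nonmult_gf_diff_order[OF _ _ nonmult_xgf_order])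
    fix B :: nat assume "B mod 15 \<in> {7, 11, 13, 14}"
    then have "order_ge (int B + 15 * int m) (xweight m m m m B)"
      by (intro xweight_order) auto
    then have "order_ge (15 * int m) (xweight m m m m B)"
      by (rule order_ge_mono) simp
    then show "order_ge (15 * int m) ((if B = 30 * 0 + 7 then inverse (xp 15) ^ 0 else 1) * xweight m m m m B)"
      by (cases "B = 7") simp_all
  next
    fix B :: nat assume "B mod 15 \<in> {3, 5, 6, 9, 10, 12}"
    then have "order_ge (int B + 15 * int m) (xweight m m m m B)"
      by (intro xweight_order) auto
    then show "order_ge (15 * int m) (xweight m m m m B)"
      by (rule order_ge_mono) simp
  qed simp
  moreover have "order_ge (15 * int m) (?c n * ?r n)" if "n \<noteq> 0" for n
  proof (rule order_ge_mult'[OF mult_gf_order nonmult_xgf_order])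
    have "15 * int m \<le> 15 * 1 * (2 * int n + 1 + int (m + m + m + m))"
      by simp
    also have "\<dots> \<le> 15 * int n * (2 * int n + 1 + int (m + m + m + m))"
      using that by (intro mult_right_mono) auto
    finally show "15 * int m \<le> 15 * int n * (2 * int n + 1 + int (m + m + m + m)) + 0" by simp
  qed
  ultimately show ?thesis
    unfolding eq by (intro order_ge_add order_ge_sum) auto
qed

lemma mult_gf_power_order: "order_ge (2 * int n) (xp 15 ^ n * mult_gf (xp 15) (xp (15 * int s - 15)) n)"
proof -
  have "order_ge (int n * 15) (xp 15 ^ n)"
    unfolding xp_power by (rule order_ge_xp) simp
  from order_ge_mult'[OF this mult_gf_order] show ?thesis
    by simp
qed

lemma partial_gf_step_xp:
  assumes "0 \<le> \<alpha> + \<delta> + 15" "0 \<le> \<beta> + \<delta> + 15" "0 \<le> \<gamma> + \<delta> + 15" "0 \<le> \<delta> + 15"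
    and s: "\<alpha> + \<beta> + \<gamma> + \<delta> = 15 * int s - 15"
    and "order_ge_seq (partial_gf (xp 15) (xp \<alpha>) (xp \<beta>) (xp \<gamma>) (xp \<delta>))"
    and "order_ge_seq (partial_gf (xp 15) (xp \<alpha>) (xp \<beta>) (xp \<gamma>) (xp (\<delta> + 15)))"
  shows "fls_close (partial_gf (xp 15) (xp \<alpha>) (xp \<beta>) (xp \<gamma>) (xp \<delta>))
    (\<lambda>M. (1 + xp (\<delta> + 15)) * partial_gf (xp 15) (xp \<alpha>) (xp \<beta>) (xp \<gamma>) (xp (\<delta> + 15)) M)"
  using partial_gf_step[of "xp \<alpha>" "xp \<delta>" "xp \<beta>" "xp \<gamma>"] mult_gf_power_order[of _ s] assms
  by (simp add: xp_mult order_ge_xp)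

lemma partial_gf_xp_rotate: "partial_gf (xp 15) a b c d = partial_gf (xp 15) b c d a"
  by (rule partial_gf_rotate) (simp_all add: xp_power_neq_1)

lemma pgf_order_seq: "order_ge_seq (pgf i j k l)"
  by (simp add: order_ge_seq_def pgf_order)

lemma pgf_step:
  "fls_close (pgf i j k l) (\<lambda>M. (1 + xp (15 * int i + 7)) * pgf (Suc i) j k l M)"
  "fls_close (pgf i j k l) (\<lambda>M. (1 + xp (15 * int j + 11)) * pgf i (Suc j) k l M)"
  "fls_close (pgf i j k l) (\<lambda>M. (1 + xp (15 * int k + 13)) * pgf i j (Suc k) l M)"
  "fls_close (pgf i j k l) (\<lambda>M. (1 + xp (15 * int l + 14)) * pgf i j k (Suc l) M)"
proof -
  have shift: "15 * int (Suc n) - c = 15 * int n - c + 15" for n c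
    by simp
  define \<alpha> \<beta> \<gamma> \<delta> where "\<alpha> = 15 * int i - 8" and "\<beta> = 15 * int j - 4"
    and "\<gamma> = 15 * int k - 2" and "\<delta> = 15 * int l - 1"
  have s: "\<alpha> + \<beta> + \<gamma> + \<delta> = 15 * int (i + j + k + l) - 15"
    by (simp add: \<alpha>_def \<beta>_def \<gamma>_def \<delta>_def)
  \<comment> \<open>Any two of the exponents then sum to at least -12, so the order hypotheses of
    \<open>partial_gf_step_xp\<close> hold whichever letter is raised.\<close>
  have bounds: "-8 \<le> \<alpha>" "-4 \<le> \<beta>" "-2 \<le> \<gamma>" "-1 \<le> \<delta>"
    by (simp_all add: \<alpha>_def \<beta>_def \<gamma>_def \<delta>_def)
  note rot = partial_gf_xp_rotate
  have eqs: "pgf i j k l = partial_gf (xp 15) (xp \<alpha>) (xp \<beta>) (xp \<gamma>) (xp \<delta>)"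
    "pgf (Suc i) j k l = partial_gf (xp 15) (xp (\<alpha> + 15)) (xp \<beta>) (xp \<gamma>) (xp \<delta>)"
    "pgf i (Suc j) k l = partial_gf (xp 15) (xp \<alpha>) (xp (\<beta> + 15)) (xp \<gamma>) (xp \<delta>)"
    "pgf i j (Suc k) l = partial_gf (xp 15) (xp \<alpha>) (xp \<beta>) (xp (\<gamma> + 15)) (xp \<delta>)"
    "pgf i j k (Suc l) = partial_gf (xp 15) (xp \<alpha>) (xp \<beta>) (xp \<gamma>) (xp (\<delta> + 15))"
    unfolding pgf_def shift \<alpha>_def \<beta>_def \<gamma>_def \<delta>_def by (rule refl)+
  have exps: "15 * int i + 7 = \<alpha> + 15" "15 * int j + 11 = \<beta> + 15" "15 * int k + 13 = \<gamma> + 15" "15 * int l + 14 = \<delta> + 15"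
    by (simp_all add: \<alpha>_def \<beta>_def \<gamma>_def \<delta>_def)
  note ord = pgf_order_seq[of i j k l] pgf_order_seq[of "Suc i" j k l] pgf_order_seq[of i "Suc j" k l]
    pgf_order_seq[of i j "Suc k" l] pgf_order_seq[of i j k "Suc l"]
  \<comment> \<open>The three rotations move the first, second and third letter to the last
    place.\<close>
  have r1: "partial_gf (xp 15) (xp a) (xp b) (xp c) (xp d) = partial_gf (xp 15) (xp b) (xp c) (xp d) (xp a)"
    and r2: "partial_gf (xp 15) (xp a) (xp b) (xp c) (xp d) = partial_gf (xp 15) (xp c) (xp d) (xp a) (xp b)"
    and r3: "partial_gf (xp 15) (xp a) (xp b) (xp c) (xp d) = partial_gf (xp 15) (xp d) (xp a) (xp b) (xp c)" for a b c d
    by (rule rot, rule trans[OF rot rot], rule rot[symmetric])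
  show "fls_close (pgf i j k l) (\<lambda>M. (1 + xp (15 * int l + 14)) * pgf i j k (Suc l) M)"
    using ord(1,5) unfolding eqs exps by (intro partial_gf_step_xp[OF _ _ _ _ s]) (use bounds in simp_all)
  show "fls_close (pgf i j k l) (\<lambda>M. (1 + xp (15 * int k + 13)) * pgf i j (Suc k) l M)"
    using ord(1,4) unfolding eqs exps r3[of \<alpha>] by (intro partial_gf_step_xp[of _ _ _ _ "i + j + k + l"]) (use bounds s in simp_all)
  show "fls_close (pgf i j k l) (\<lambda>M. (1 + xp (15 * int j + 11)) * pgf i (Suc j) k l M)"
    using ord(1,3) unfolding eqs exps r2[of \<alpha>] by (intro partial_gf_step_xp[of _ _ _ _ "i + j + k + l"]) (use bounds s in simp_all)
  show "fls_close (pgf i j k l) (\<lambda>M. (1 + xp (15 * int i + 7)) * pgf (Suc i) j k l M)"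
    using ord(1,2) unfolding eqs exps r1[of _ \<beta>] by (intro partial_gf_step_xp[of _ _ _ _ "i + j + k + l"]) (use bounds s in simp_all)
qed

section \<open>The limit and its infinite product\<close>

text \<open>By \<open>pgf_stable\<close> the coefficient of x^n is constant from M = n + 1 on, so it
  can be read off there.\<close>

definition limit_gf :: "nat \<Rightarrow> nat \<Rightarrow> nat \<Rightarrow> nat \<Rightarrow> rat fps" where
  "limit_gf i j k l = Abs_fps (\<lambda>n. fls_nth (pgf i j k l (Suc n)) (int n))"

lemma limit_gf_nth: "n < M \<Longrightarrow> fls_nth (pgf i j k l M) (int n) = fps_nth (limit_gf i j k l) n"
  using pgf_stable[of "Suc n" M i j k l] by (simp add: order_ge_def limit_gf_def)

lemma limit_gf_close:
  assumes "fls_close (pgf i j k l) (\<lambda>M. (1 + xp (int c)) * pgf i' j' k' l' M)"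
  shows "limit_gf i j k l = (1 + fps_X ^ c) * limit_gf i' j' k' l'"
proof (rule fps_ext)
  fix n
  let ?f = "pgf i j k l (Suc n)" and ?g = "pgf i' j' k' l' (Suc n)"
  have "fls_nth (?f - (1 + xp (int c)) * ?g) (int n) = 0"
    using assms by (simp add: fls_close_def order_ge_def)
  then have "fls_nth ?f (int n) = fls_nth ?g (int n) + fls_nth ?g (int n - int c)"
    by (simp add: distrib_right xp_times_nth)
  \<comment> \<open>For n < c the index is negative and \<open>pgf_order\<close> makes the
    coefficient zero.\<close>
  also have "fls_nth ?g (int n - int c) = (if n < c then 0 else fps_nth (limit_gf i' j' k' l') (n - c))"
    using pgf_order[of i' j' k' l' "Suc n"] limit_gf_nth[of "n - c" "Suc n" i' j' k' l']
    by (auto simp: order_ge_def of_nat_diff)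
  finally show "fps_nth (limit_gf i j k l) n = fps_nth ((1 + fps_X ^ c) * limit_gf i' j' k' l') n"
    by (simp add: limit_gf_nth distrib_right fps_X_power_mult_nth)
qed

lemma limit_gf_diagonal_step:
  "limit_gf m m m m = (1 + fps_X ^ (15 * m + 7)) * (1 + fps_X ^ (15 * m + 11)) * (1 + fps_X ^ (15 * m + 13))
     * (1 + fps_X ^ (15 * m + 14)) * limit_gf (Suc m) (Suc m) (Suc m) (Suc m)"
proof -
  have e: "15 * int m + 7 = int (15 * m + 7)" "15 * int m + 11 = int (15 * m + 11)"
    "15 * int m + 13 = int (15 * m + 13)" "15 * int m + 14 = int (15 * m + 14)"
    by simp_all
  show ?thesis
    unfolding limit_gf_close[OF pgf_step(1)[where i = m, unfolded e]]
    unfolding limit_gf_close[OF pgf_step(2)[where j = m, unfolded e]]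
    unfolding limit_gf_close[OF pgf_step(3)[where k = m, unfolded e]]
    unfolding limit_gf_close[OF pgf_step(4)[where l = m, unfolded e]]
    by (simp only: mult.assoc)
qed

lemma limit_gf_diagonal_nth: "n < 15 * m \<Longrightarrow> fps_nth (limit_gf m m m m) n = (if n = 0 then 1 else 0)"
  using pgf_diagonal[of m "Suc n"] by (auto simp: order_ge_def limit_gf_def)

definition primary_parts :: "nat \<Rightarrow> nat set" where
  "primary_parts m = {x. x < 15 * m \<and> x mod 15 \<in> {7, 11, 13, 14}}"

lemma primary_parts_Suc:
  "primary_parts (Suc m) = {15 * m + 7, 15 * m + 11, 15 * m + 13, 15 * m + 14} \<union> primary_parts m"
proof -
  have "x \<in> primary_parts (Suc m) \<longleftrightarrow> x \<in> {15 * m + 7, 15 * m + 11, 15 * m + 13, 15 * m + 14} \<union> primary_parts m" for x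
  proof (cases "x < 15 * m")
    case False
    then obtain r where x: "x = 15 * m + r"
      by (metis le_Suc_ex not_less)
    show ?thesis
    proof (cases "r < 15")
      case True
      then show ?thesis
        unfolding x primary_parts_def by auto
    qed (auto simp: x primary_parts_def)
  qed (auto simp: primary_parts_def)
  then show ?thesis by blast
qed

lemma finite_primary_parts: "finite (primary_parts m)"
  by (rule finite_subset[of _ "{..<15 * m}"]) (auto simp: primary_parts_def)

lemma limit_gf_product: "limit_gf 0 0 0 0 = (\<Prod>x\<in>primary_parts m. 1 + fps_X ^ x) * limit_gf m m m m"
proof (induction m)
  case 0
  then show ?case by (simp add: primary_parts_def)
next
  case (Suc m)
  have "(\<Prod>x\<in>primary_parts (Suc m). 1 + fps_X ^ x :: rat fps)
      = (\<Prod>x\<in>{15 * m + 7, 15 * m + 11, 15 * m + 13, 15 * m + 14}. 1 + fps_X ^ x) * (\<Prod>x\<in>primary_parts m. 1 + fps_X ^ x)"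
    unfolding primary_parts_Suc by (rule prod.union_disjoint) (auto simp: finite_primary_parts, auto simp: primary_parts_def)
  then show ?case
    unfolding Suc.IH limit_gf_diagonal_step[of m] by (simp add: mult_ac)
qed

theorem limit_gf_eq_P: "fps_nth (limit_gf 0 0 0 0) n = of_nat (P n)"
proof -
  \<comment> \<open>Then n < 15 m: the remaining factor \<open>limit_gf m m m m\<close> agrees with
    1 up to degree n, and all parts of a partition of n lie below 15 m.\<close>
  define m where "m = Suc n"
  define A where "A = primary_parts m"
  have "fps_nth (limit_gf 0 0 0 0) n = (\<Sum>i\<le>n. fps_nth (\<Prod>x\<in>A. 1 + fps_X ^ x) (n - i) * fps_nth (limit_gf m m m m) i)"
    unfolding limit_gf_product[of m] A_def by (subst mult.commute) (simp add: fps_mult_nth atMost_atLeast0 mult.commute)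
  also have "\<dots> = (\<Sum>i\<le>n. if i = 0 then fps_nth (\<Prod>x\<in>A. 1 + fps_X ^ x) n else 0)"
    by (rule sum.cong) (auto simp: limit_gf_diagonal_nth m_def)
  also have "\<dots> = fps_nth (\<Prod>x\<in>A. fps_X ^ x + 1) n"
    by (simp add: add.commute)
  \<comment> \<open>Expanding the product chooses a subset of \<open>A\<close>, that is, a set of
    distinct parts.\<close>
  also have "(\<Prod>x\<in>A. fps_X ^ x + 1 :: rat fps) = (\<Sum>S\<in>Pow A. fps_X ^ (\<Sum>S))"
    by (simp add: prod_add A_def finite_primary_parts power_sum)
  also have "fps_nth \<dots> n = (\<Sum>S\<in>Pow A. if \<Sum>S = n then 1 else 0)"
    by (auto simp: fps_sum_nth fps_X_power_nth intro!: sum.cong)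
  also have "\<dots> = of_nat (card {S \<in> Pow A. \<Sum>S = n})"
    by (simp add: sum.inter_filter[symmetric] A_def finite_primary_parts)
  also have "{S \<in> Pow A. \<Sum>S = n} = {S. finite S \<and> (\<forall>x\<in>S. 0 < x \<and> x mod 15 \<in> {7, 11, 13, 14}) \<and> \<Sum>S = n}"
  proof (intro set_eqI iffI)
    fix S assume "S \<in> {S \<in> Pow A. \<Sum>S = n}"
    moreover have "x mod 15 \<in> {7, 11, 13, 14} \<and> 0 < x" if "x \<in> A" for x
      using that by (cases x) (auto simp: A_def primary_parts_def)
    ultimately show "S \<in> {S. finite S \<and> (\<forall>x\<in>S. 0 < x \<and> x mod 15 \<in> {7, 11, 13, 14}) \<and> \<Sum>S = n}"
      using finite_subset[of S A] finite_primary_parts[of m] unfolding A_def by blast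
  next
    fix S assume S: "S \<in> {S. finite S \<and> (\<forall>x\<in>S. 0 < x \<and> x mod 15 \<in> {7, 11, 13, 14}) \<and> \<Sum>S = n}"
    have "x \<in> A" if "x \<in> S" for x
    proof -
      have "x \<le> \<Sum>S"
        using S that by (intro member_le_sum) auto
      with S that show ?thesis by (auto simp: A_def primary_parts_def m_def)
    qed
    with S show "S \<in> {S \<in> Pow A. \<Sum>S = n}" by blast
  qed
  finally show ?thesis
    unfolding P_def .
qed

section \<open>Combinatorial interpretation\<close>

lemma less_15_cases: "r < 15 \<Longrightarrow> r \<in> {0, 1, 2, 3, 4, 5, 6, 7, 8, 9, 10, 11, 12, 13, 14 :: nat}"
  by (simp add: numeral_eq_Suc less_Suc_eq)

lemma coprime_15_iff: "coprime y (15::nat) \<longleftrightarrow> y mod 15 \<in> {1, 2, 4, 7, 8, 11, 13, 14}"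
proof -
  have "coprime y (15::nat) \<longleftrightarrow> gcd (y mod 15) 15 = 1"
    by (simp only: coprime_iff_gcd_eq_1 gcd_mod_left)
  moreover have "y mod 15 \<in> {0, 1, 2, 3, 4, 5, 6, 7, 8, 9, 10, 11, 12, 13, 14}"
    by (rule less_15_cases) simp
  ultimately show ?thesis
    by (elim insertE emptyE; simp add: gcd_non_0_nat)
qed

definition nonmult_gap :: "nat \<Rightarrow> nat \<Rightarrow> bool" where
  "nonmult_gap y x \<longleftrightarrow> y + 15 \<le> x \<and> (x = y + 15 \<longrightarrow> coprime y 15)"

definition mult_gap :: "nat \<Rightarrow> nat \<Rightarrow> bool" where
  "mult_gap y x \<longleftrightarrow> y + 60 \<le> x"

definition nonmult_list :: "nat \<Rightarrow> nat list \<Rightarrow> bool" where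
  "nonmult_list L ys \<longleftrightarrow> sorted_wrt nonmult_gap ys \<and>
     (\<forall>y\<in>set ys. L < y \<and> y mod 15 \<notin> {0, 1, 2, 4, 8} \<and> (\<not> coprime y 15 \<longrightarrow> L + 15 < y))"

definition nonmult_lists :: "nat \<Rightarrow> nat \<Rightarrow> nat list set" where
  "nonmult_lists L B = {ys. nonmult_list L ys \<and> (\<forall>y\<in>set ys. y \<le> B)}"

lemma residues_15: "y mod 15 \<in> {0, 1, 2, 4, 8} \<or> y mod 15 \<in> {7, 11, 13, 14} \<or> y mod 15 \<in> {3, 5, 6, 9, 10, 12}"
  for y :: nat
proof -
  have "y mod 15 < 15" by simp
  from less_15_cases[OF this] show ?thesis
    by (elim insertE emptyE) simp_all
qed

lemma residues_15_disjoint: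
  fixes y :: nat
  shows "y mod 15 \<in> {7, 11, 13, 14} \<Longrightarrow> y mod 15 \<notin> {0, 1, 2, 4, 8} \<and> coprime y 15 \<and> y mod 15 \<notin> {3, 5, 6, 9, 10, 12}"
    and "y mod 15 \<in> {3, 5, 6, 9, 10, 12} \<Longrightarrow> y mod 15 \<notin> {0, 1, 2, 4, 8} \<and> \<not> coprime y 15"
  unfolding coprime_15_iff by (elim insertE emptyE; simp)+

text \<open>Among the offsets 1 to 6 above 30 n, the residues 1, 2, 4 are excluded, and 3, 5, 6 are
  not coprime to 15, so they would have to exceed 30 n + 15.\<close>

lemma nonmult_lists_small:
  assumes "B \<le> 30 * n + 6"
  shows "nonmult_lists (30 * n) B = {[]}"
proof -
  have "False" if "30 * n < y" "y mod 15 \<notin> {0, 1, 2, 4, 8}" "\<not> coprime y 15 \<longrightarrow> 30 * n + 15 < y" "y \<le> B" for y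
  proof -
    define r where "r = y - 30 * n"
    have y: "y = 30 * n + r" and r: "0 < r" "r < 7"
      using that(1,4) assms by (simp_all add: r_def)
    have "r \<in> {1, 2, 3, 4, 5, 6}"
      using r by (simp add: numeral_eq_Suc less_Suc_eq)
    moreover have "y mod 15 = r mod 15"
      unfolding y using mod_mult_self4[of 15 "2 * n" r] by (simp add: mult.assoc[symmetric])
    ultimately show False
      using that assms unfolding coprime_15_iff by (elim insertE emptyE) (simp_all add: y)
  qed
  then show ?thesis
    unfolding nonmult_lists_def nonmult_list_def using last_in_set by fastforce
qed

text \<open>The gaps make the list strictly increasing, so the maximal value \<open>B\<close> can
  occur only as its last entry.\<close>

lemma nonmult_lists_split:
  assumes "0 < B"
  shows "nonmult_lists L B = nonmult_lists L (B - 1) \<union>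
    (\<lambda>ys. ys @ [B]) ` {ys. nonmult_list L (ys @ [B])}"
proof (intro set_eqI iffI)
  fix ys assume ys: "ys \<in> nonmult_lists L B"
  show "ys \<in> nonmult_lists L (B - 1) \<union> (\<lambda>ys. ys @ [B]) ` {ys. nonmult_list L (ys @ [B])}"
  proof (cases "B \<in> set ys")
    case True
    then obtain us vs where us: "ys = us @ B # vs"
      by (meson split_list)
    have "vs = []"
    proof (rule ccontr)
      assume "vs \<noteq> []"
      then obtain v where "v \<in> set vs" by (meson last_in_set)
      with ys have "nonmult_gap B v" "v \<le> B"
        unfolding us nonmult_lists_def nonmult_list_def by (auto simp: sorted_wrt_append)
      then show False by (simp add: nonmult_gap_def)
    qed
    with ys us show ?thesis by (auto simp: nonmult_lists_def)
  next
    case False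
    have "y \<le> B - 1" if "y \<in> set ys" for y
    proof -
      have "y \<le> B" "y \<noteq> B" using ys that False by (auto simp: nonmult_lists_def)
      then show ?thesis by simp
    qed
    with ys show ?thesis by (auto simp: nonmult_lists_def)
  qed
next
  fix ys assume "ys \<in> nonmult_lists L (B - 1) \<union> (\<lambda>ys. ys @ [B]) ` {ys. nonmult_list L (ys @ [B])}"
  then show "ys \<in> nonmult_lists L B"
  proof
    assume "ys \<in> nonmult_lists L (B - 1)"
    then show ?thesis by (force simp: nonmult_lists_def)
  next
    assume "ys \<in> (\<lambda>ys. ys @ [B]) ` {ys. nonmult_list L (ys @ [B])}"
    then obtain zs where zs: "ys = zs @ [B]" "nonmult_list L (zs @ [B])" by blast
    then have "\<forall>y\<in>set zs. nonmult_gap y B"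
      by (simp add: nonmult_list_def sorted_wrt_append)
    then show ?thesis
      using zs by (auto simp: nonmult_lists_def nonmult_gap_def dest: bspec)
  qed
qed

lemma nonmult_list_snoc:
  "nonmult_list L (ys @ [B]) \<longleftrightarrow> nonmult_list L ys \<and> (\<forall>y\<in>set ys. nonmult_gap y B) \<and>
     L < B \<and> B mod 15 \<notin> {0, 1, 2, 4, 8} \<and> (\<not> coprime B 15 \<longrightarrow> L + 15 < B)"
  unfolding nonmult_list_def sorted_wrt_append by auto

lemma coprime_add_15: "coprime (y + 15) 15 \<longleftrightarrow> coprime y (15::nat)"
  unfolding coprime_15_iff by simp

text \<open>At distance 15 both parts have the same residue, so coprimality of \<open>y\<close> can
  be tested on \<open>B\<close>. Positivity of \<open>y\<close> rules out that the truncated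
  difference is 0.\<close>

lemma nonmult_gap_primary: "coprime B 15 \<Longrightarrow> 0 < y \<Longrightarrow> nonmult_gap y B \<longleftrightarrow> y \<le> B - 15"
  using coprime_add_15[of y] by (cases "B = y + 15") (auto simp: nonmult_gap_def)

lemma nonmult_gap_secondary: "\<not> coprime B 15 \<Longrightarrow> 0 < y \<Longrightarrow> nonmult_gap y B \<longleftrightarrow> y \<le> B - 16"
  using coprime_add_15[of y] by (cases "B = y + 15") (auto simp: nonmult_gap_def)

lemma nonmult_lists_skip:
  assumes "B mod 15 \<in> {0, 1, 2, 4, 8}" "0 < B"
  shows "nonmult_lists L B = nonmult_lists L (B - 1)"
proof -
  have "{ys. nonmult_list L (ys @ [B])} = {}"
    using assms(1) unfolding nonmult_list_snoc by blast
  then show ?thesis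
    using nonmult_lists_split[OF assms(2)] by simp
qed

lemma nonmult_list_pos: "nonmult_list L ys \<Longrightarrow> y \<in> set ys \<Longrightarrow> 0 < y"
  by (auto simp: nonmult_list_def)

lemma nonmult_lists_primary:
  assumes "B mod 15 \<in> {7, 11, 13, 14}" "L < B"
  shows "nonmult_lists L B = nonmult_lists L (B - 1) \<union> (\<lambda>ys. ys @ [B]) ` nonmult_lists L (B - 15)"
proof -
  note d = residues_15_disjoint(1)[OF assms(1)]
  have "(\<forall>y\<in>set ys. nonmult_gap y B) \<longleftrightarrow> (\<forall>y\<in>set ys. y \<le> B - 15)" if "nonmult_list L ys" for ys
    using d that by (intro ball_cong refl nonmult_gap_primary) (auto dest: nonmult_list_pos)
  then have "{ys. nonmult_list L (ys @ [B])} = nonmult_lists L (B - 15)"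
    unfolding nonmult_list_snoc nonmult_lists_def using d assms(2) by auto
  then show ?thesis
    using nonmult_lists_split[of B L] assms(2) by simp
qed

lemma nonmult_lists_secondary:
  assumes "B mod 15 \<in> {3, 5, 6, 9, 10, 12}" "0 < B"
  shows "nonmult_lists L B = nonmult_lists L (B - 1) \<union>
    (if L + 15 < B then (\<lambda>ys. ys @ [B]) ` nonmult_lists L (B - 16) else {})"
proof -
  note d = residues_15_disjoint(2)[OF assms(1)]
  have gap: "(\<forall>y\<in>set ys. nonmult_gap y B) \<longleftrightarrow> (\<forall>y\<in>set ys. y \<le> B - 16)" if "nonmult_list L ys" for ys
    using d that by (intro ball_cong refl nonmult_gap_secondary) (auto dest: nonmult_list_pos)
  have "L < B" if "L + 15 < B" using that by simp
  then have "{ys. nonmult_list L (ys @ [B])} = (if L + 15 < B then nonmult_lists L (B - 16) else {})"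
    unfolding nonmult_list_snoc nonmult_lists_def using d gap by (cases "L + 15 < B") auto
  then show ?thesis
    using nonmult_lists_split[OF assms(2)] by simp
qed

definition list_weight :: "(nat \<Rightarrow> 'a::comm_ring_1) \<Rightarrow> 'a \<Rightarrow> nat \<Rightarrow> nat list \<Rightarrow> 'a" where
  "list_weight w s L ys = (if L + 7 \<in> set ys then s else 1) * prod_list (map w ys)"

lemma nonmult_gf_eq_sum:
  "finite (nonmult_lists (30 * n) B) \<and>
   nonmult_gf w s (30 * n) B = (\<Sum>ys\<in>nonmult_lists (30 * n) B. list_weight w s (30 * n) ys)"
proof (induction B rule: less_induct)
  case (less B)
  define L where "L = 30 * n"
  show ?case
  proof (cases "B \<le> L + 6")
    case True
    then show ?thesis
      by (simp add: L_def nonmult_lists_small nonmult_gf_base list_weight_def)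
  next
    case False
    then have B: "0 < B" "L + 6 < B" "B - 1 < B" "B - 15 < B" "B - 16 < B" by simp_all
    \<comment> \<open>Appending \<open>B\<close> is treated at once for \<open>B' = B - 15\<close>
      (primary) and \<open>B' = B - 16\<close> (secondary).\<close>
    have snoc: "finite (nonmult_lists L (B - 1) \<union> (\<lambda>ys. ys @ [B]) ` nonmult_lists L B') \<and>
        (\<Sum>ys\<in>nonmult_lists L (B - 1) \<union> (\<lambda>ys. ys @ [B]) ` nonmult_lists L B'. list_weight w s L ys)
        = nonmult_gf w s L (B - 1) + (if B = L + 7 then s else 1) * w B * nonmult_gf w s L B'"
      if B': "B' \<le> B - 15" for B'
    proof -
      have lt: "B' < B" using B(4) B' by simp
      note IH = less[OF B(3), folded L_def] less[OF lt, folded L_def]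
      have "B \<notin> set ys" if "ys \<in> nonmult_lists L (B - 1)" for ys
        using that B(1) by (auto simp: nonmult_lists_def)
      then have disj: "nonmult_lists L (B - 1) \<inter> (\<lambda>ys. ys @ [B]) ` nonmult_lists L B' = {}"
        by fastforce
      \<comment> \<open>If B = L + 7, the rest of the list is empty and \<open>s\<close> is
        contributed by \<open>B\<close>; otherwise \<open>B\<close> does not affect whether L + 7
        occurs.\<close>
      have "list_weight w s L (ys @ [B]) = (if B = L + 7 then s else 1) * w B * list_weight w s L ys"
        if "ys \<in> nonmult_lists L B'" for ys
      proof (cases "B = L + 7")
        case True
        then have "nonmult_lists L B' = {[]}"
          using B' unfolding L_def by (intro nonmult_lists_small) simp
        with that True show ?thesis by (simp add: list_weight_def)
      next
        case False
        then show ?thesis by (auto simp: list_weight_def)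
      qed
      then have "(\<Sum>ys\<in>(\<lambda>ys. ys @ [B]) ` nonmult_lists L B'. list_weight w s L ys)
          = (if B = L + 7 then s else 1) * w B * nonmult_gf w s L B'"
        using IH by (subst sum.reindex) (auto simp: inj_on_def sum_distrib_left)
      moreover have "finite ((\<lambda>ys. ys @ [B]) ` nonmult_lists L B')"
        using IH by simp
      ultimately show ?thesis
        using IH disj by (simp add: sum.union_disjoint)
    qed
    note IH = less[OF B(3), folded L_def]
    consider "B mod 15 \<in> {0, 1, 2, 4, 8}" | "B mod 15 \<in> {7, 11, 13, 14}" | "B mod 15 \<in> {3, 5, 6, 9, 10, 12}"
      using residues_15 by blast
    then show ?thesis
      unfolding L_def[symmetric]
    proof cases
      case 1
      show "finite (nonmult_lists L B) \<and> nonmult_gf w s L B = (\<Sum>ys\<in>nonmult_lists L B. list_weight w s L ys)"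
        unfolding nonmult_lists_skip[OF 1 B(1)] nonmult_gf_skip[OF 1] by (rule IH)
    next
      case 2
      have "L < B" using B(2) by simp
      show "finite (nonmult_lists L B) \<and> nonmult_gf w s L B = (\<Sum>ys\<in>nonmult_lists L B. list_weight w s L ys)"
        unfolding nonmult_lists_primary[OF 2 \<open>L < B\<close>] nonmult_gf_primary[OF 2 B(2)]
        using snoc[OF order.refl] by simp
    next
      case 3
      have "B \<noteq> L + 7" if "L + 15 < B" using that by simp
      then show "finite (nonmult_lists L B) \<and> nonmult_gf w s L B = (\<Sum>ys\<in>nonmult_lists L B. list_weight w s L ys)"
        unfolding nonmult_lists_secondary[OF 3 B(1)] nonmult_gf_secondary[OF 3]
        using snoc[of "B - 16"] IH by (cases "L + 15 < B") simp_all
    qed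
  qed
qed

section \<open>Lists of multiples of 15\<close>

definition mult_lists :: "nat \<Rightarrow> nat \<Rightarrow> nat \<Rightarrow> nat list set" where
  "mult_lists c m N = {ms. length ms = m \<and> sorted_wrt mult_gap ms \<and> (\<forall>x\<in>set ms. 15 dvd x \<and> c \<le> x) \<and> sum_list ms = N}"

lemma sum_list_map_add: "sum_list (map (\<lambda>x. x + c) ms) = sum_list ms + c * length (ms :: nat list)"
  by (induction ms) auto

lemma mult_gap_add: "mult_gap (x + c) (y + c) \<longleftrightarrow> mult_gap x y"
  by (simp add: mult_gap_def)

lemma finite_nat_lists: "finite {ms :: nat list. length ms = m \<and> sum_list ms = N}"
proof (rule finite_subset)
  show "{ms :: nat list. length ms = m \<and> sum_list ms = N} \<subseteq> {ms. set ms \<subseteq> {..N} \<and> length ms = m}"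
    using member_le_sum_list by fastforce
  show "finite {ms. set ms \<subseteq> {..N} \<and> length ms = m}"
    by (rule finite_lists_length_eq) simp
qed

lemma finite_mult_lists: "finite (mult_lists c m N)"
  by (rule finite_subset[OF _ finite_nat_lists[of m N]]) (auto simp: mult_lists_def)

lemma sum_list_ge: "(\<And>x. x \<in> set ms \<Longrightarrow> c \<le> x) \<Longrightarrow> c * length ms \<le> sum_list (ms :: nat list)"
  by (induction ms) force+

lemma bij_betw_mult_lists_shift:
  "bij_betw (map (\<lambda>x. x + 15 * k)) (mult_lists c m N) (mult_lists (c + 15 * k) m (N + 15 * k * m))"
proof (rule bij_betw_byWitness[where f' = "map (\<lambda>x. x - 15 * k)"])
  show "\<forall>ms\<in>mult_lists c m N. map (\<lambda>x. x - 15 * k) (map (\<lambda>x. x + 15 * k) ms) = ms"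
    by (simp add: comp_def)
  have inv: "map (\<lambda>x. x + 15 * k) (map (\<lambda>x. x - 15 * k) ms) = ms" if "ms \<in> mult_lists (c + 15 * k) m (N + 15 * k * m)" for ms
    using that by (auto simp: mult_lists_def intro!: map_idI)
  then show "\<forall>ms\<in>mult_lists (c + 15 * k) m (N + 15 * k * m). map (\<lambda>x. x + 15 * k) (map (\<lambda>x. x - 15 * k) ms) = ms"
    by blast
  have iff: "map (\<lambda>x. x + 15 * k) ms \<in> mult_lists (c + 15 * k) m (N + 15 * k * m) \<longleftrightarrow> ms \<in> mult_lists c m N" for ms
    by (auto simp: mult_lists_def sorted_wrt_map mult_gap_add sum_list_map_add dvd_add_left_iff)
  then show "map (\<lambda>x. x + 15 * k) ` mult_lists c m N \<subseteq> mult_lists (c + 15 * k) m (N + 15 * k * m)"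
    by blast
  show "map (\<lambda>x. x - 15 * k) ` mult_lists (c + 15 * k) m (N + 15 * k * m) \<subseteq> mult_lists c m N"
  proof (rule image_subsetI)
    fix ms assume ms: "ms \<in> mult_lists (c + 15 * k) m (N + 15 * k * m)"
    show "map (\<lambda>x. x - 15 * k) ms \<in> mult_lists c m N"
      unfolding iff[symmetric] inv[OF ms] by (rule ms)
  qed
qed

lemma card_mult_lists_shift: "card (mult_lists (c + 15 * k) m (N + 15 * k * m)) = card (mult_lists c m N)"
  by (rule bij_betw_same_card[OF bij_betw_mult_lists_shift, symmetric])

lemma mult_lists_empty: "N < c * m \<Longrightarrow> mult_lists c m N = {}"
proof (rule ccontr)
  assume "N < c * m" "mult_lists c m N \<noteq> {}"
  then obtain ms where "ms \<in> mult_lists c m N" by blast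
  then have "c * m \<le> N"
    using sum_list_ge[of ms c] by (auto simp: mult_lists_def)
  with \<open>N < c * m\<close> show False by simp
qed

text \<open>If the least part is not 45, all parts are at least 60 and can be lowered by 15. If it
  is 45, remove it; the other m parts are at least 105 and can be lowered by 60.\<close>

lemma card_mult_lists_Suc:
  "card (mult_lists 45 (Suc m) N) =
    (if 15 * Suc m \<le> N then card (mult_lists 45 (Suc m) (N - 15 * Suc m)) else 0)
    + (if 45 + 60 * m \<le> N then card (mult_lists 45 m (N - (45 + 60 * m))) else 0)"
proof -
  have split: "mult_lists 45 (Suc m) N = mult_lists 60 (Suc m) N \<union>
      (if 45 \<le> N then Cons 45 ` mult_lists 105 m (N - 45) else {})" (is "_ = _ \<union> ?B")
  proof (intro set_eqI iffI)
    fix ms assume ms: "ms \<in> mult_lists 45 (Suc m) N"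
    then obtain x xs where x: "ms = x # xs"
      by (auto simp: mult_lists_def length_Suc_conv)
    have m: "length xs = m" "sorted_wrt mult_gap xs" "\<And>y. y \<in> set xs \<Longrightarrow> x + 60 \<le> y \<and> 15 dvd y" "x + sum_list xs = N" "15 dvd x" "45 \<le> x"
      using ms unfolding x by (simp_all add: mult_lists_def mult_gap_def)
    show "ms \<in> mult_lists 60 (Suc m) N \<union> ?B"
    proof (cases "x = 45")
      case True
      then have "xs \<in> mult_lists 105 m (N - 45)" "45 \<le> N"
        using m by (auto simp: mult_lists_def)
      then show ?thesis
        unfolding x True by simp
    next
      case False
      then have "60 \<le> x"
        using m(5,6) by (auto elim!: dvdE)
      then have "60 \<le> y" if "y \<in> set ms" for y
        using that m(3)[of y] unfolding x by auto
      then have "ms \<in> mult_lists 60 (Suc m) N"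
        using ms by (simp add: mult_lists_def)
      then show ?thesis by blast
    qed
  next
    fix ms assume ms: "ms \<in> mult_lists 60 (Suc m) N \<union> ?B"
    then consider "ms \<in> mult_lists 60 (Suc m) N" | "45 \<le> N" "ms \<in> Cons 45 ` mult_lists 105 m (N - 45)"
      by (auto split: if_splits)
    then show "ms \<in> mult_lists 45 (Suc m) N"
    proof cases
      case 1
      then show ?thesis by (force simp: mult_lists_def)
    next
      case 2
      then obtain xs where xs: "ms = 45 # xs" "xs \<in> mult_lists 105 m (N - 45)"
        by blast
      then have "45 \<le> y \<and> mult_gap 45 y" if "y \<in> set xs" for y
        using that by (auto simp: mult_lists_def mult_gap_def)
      with xs 2(1) show ?thesis
        by (simp add: mult_lists_def)
    qed
  qed
  have "45 \<in> set ms" if "ms \<in> ?B" for ms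
    using that by (auto split: if_splits)
  moreover have "45 \<notin> set ms" if "ms \<in> mult_lists 60 (Suc m) N" for ms
    using that by (auto simp: mult_lists_def)
  ultimately have "mult_lists 60 (Suc m) N \<inter> ?B = {}"
    by blast
  then have "card (mult_lists 45 (Suc m) N) = card (mult_lists 60 (Suc m) N) + card ?B"
    unfolding split by (intro card_Un_disjoint) (simp_all add: finite_mult_lists)
  also have "card (mult_lists 60 (Suc m) N) = (if 15 * Suc m \<le> N then card (mult_lists 45 (Suc m) (N - 15 * Suc m)) else 0)"
  proof (cases "15 * Suc m \<le> N")
    case True
    then have "N - 15 * Suc m + 15 * 1 * Suc m = N"
      by (simp only: mult_1_right le_add_diff_inverse2)
    then show ?thesis
      using card_mult_lists_shift[of 45 1 "Suc m" "N - 15 * Suc m"] True by simp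
  next
    case False
    then show ?thesis
      using mult_lists_empty[of N 60 "Suc m"] by simp
  qed
  also have "card ?B = (if 45 + 60 * m \<le> N then card (mult_lists 45 m (N - (45 + 60 * m))) else 0)"
  proof (cases "45 + 60 * m \<le> N")
    case True
    have "card (mult_lists 105 m (N - 45)) = card (mult_lists 45 m (N - (45 + 60 * m)))"
      using card_mult_lists_shift[of 45 4 m "N - (45 + 60 * m)"] True by (simp add: algebra_simps)
    then show ?thesis
      using True by (simp add: card_image)
  next
    case False
    then have "N - 45 < 105 * m \<or> N < 45" by auto
    then show ?thesis
      using False mult_lists_empty[of "N - 45" 105 m] by auto
  qed
  finally show ?thesis .
qed

text \<open>\<open>card_mult_lists_Suc\<close> gives (1 - q^(m+1)) h(m+1) = x^(45 + 60 m) h(m). With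
  e = x^-15 the closed form satisfies the same recurrence, its power of x growing by -15 + 60 (m +
  1).\<close>

lemma mult_gf_nth:
  "fls_nth (mult_gf (xp 15) (xp (- 15)) m) n = (if n < 0 then 0 else of_nat (card (mult_lists 45 m (nat n))))"
proof -
  define h where "h m = fps_to_fls (Abs_fps (\<lambda>N. of_nat (card (mult_lists 45 m N)) :: rat))" for m
  have h_nth: "fls_nth (h m) n = (if n < 0 then 0 else of_nat (card (mult_lists 45 m (nat n))))" for m n
    by (simp add: h_def)
  have "h m = mult_gf (xp 15) (xp (- 15)) m"
  proof (induction m)
    case 0
    have "mult_lists 45 0 N = (if N = 0 then {[]} else {})" for N
      by (auto simp: mult_lists_def)
    then have "h 0 = 1"
      by (intro fls_eqI) (auto simp: h_nth fls_one_nth)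
    then show ?case by (simp add: mult_gf_def)
  next
    case (Suc m)
    define Q where "Q = 1 - xp (15 * int (Suc m))"
    have Q: "Q = 1 - xp 15 ^ Suc m"
      by (simp add: Q_def xp_power mult.commute del: of_nat_Suc power_Suc)
    then have Q0: "Q \<noteq> 0"
      using xp_power_neq_1[of "Suc m"] by (simp del: power_Suc)
    have "h (Suc m) = xp (15 * int (Suc m)) * h (Suc m) + xp (45 + 60 * int m) * h m"
    proof (rule fls_eqI)
      fix n
      show "fls_nth (h (Suc m)) n = fls_nth (xp (15 * int (Suc m)) * h (Suc m) + xp (45 + 60 * int m) * h m) n"
      proof (cases "n < 0")
        case True
        then show ?thesis by (simp add: xp_times_nth h_nth)
      next
        case False
        then obtain N where n: "n = int N"
          by (metis not_less zero_le_imp_eq_int)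
        have "nat (int N - 15 * int (Suc m)) = N - 15 * Suc m" "nat (int N - (45 + 60 * int m)) = N - (45 + 60 * m)"
          "(int N - 15 * int (Suc m) < 0) = (\<not> 15 * Suc m \<le> N)" "(int N - (45 + 60 * int m) < 0) = (\<not> 45 + 60 * m \<le> N)"
          by auto
        then show ?thesis
          unfolding n using card_mult_lists_Suc[of m N] by (simp add: xp_times_nth h_nth del: of_nat_Suc)
      qed
    qed
    then have "Q * h (Suc m) = xp (45 + 60 * int m) * h m"
      unfolding Q_def by (simp add: algebra_simps)
    also have "\<dots> = Q * mult_gf (xp 15) (xp (- 15)) (Suc m)"
      unfolding Suc.IH mult_gf_def qprod_Suc Q[symmetric] using Q0
      by (simp add: xp_power xp_mult algebra_simps power2_eq_square)
    finally show ?case using Q0 by simp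
  qed
  then show ?thesis
    by (metis h_nth)
qed

section \<open>Counting the shifted pairs\<close>

text \<open>The part 30 \<open>length ms\<close> + 7 is the shifted 7. Giving
  \<open>mult_lists\<close> the length and sum of \<open>ms\<close> itself imposes just the gaps,
  divisibility and the lower bound.\<close>

definition shifted_pairs :: "nat \<Rightarrow> (nat list \<times> nat list) set" where
  "shifted_pairs n = {(ys, ms). nonmult_list (30 * length ms) ys
     \<and> ms \<in> mult_lists (if 30 * length ms + 7 \<in> set ys then 30 else 45) (length ms) (sum_list ms)
     \<and> sum_list ys + sum_list ms = n}"

lemma xweight_0: "B mod 15 \<notin> {0, 1, 2, 4, 8} \<Longrightarrow> xweight 0 0 0 0 B = xp (int B)"
proof -
  assume "B mod 15 \<notin> {0, 1, 2, 4, 8}"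
  then have "B mod 15 \<in> {3, 5, 6, 7, 9, 10, 11, 12, 13, 14}"
    using residues_15[of B] by blast
  from xweight_xp[OF this, of 0 0 0 0] show ?thesis by simp
qed

lemma list_weight_xp:
  assumes "nonmult_list L ys"
  shows "list_weight (xweight 0 0 0 0) s L ys = (if L + 7 \<in> set ys then s else 1) * xp (int (sum_list ys))"
proof -
  have "\<forall>y\<in>set ys. xweight 0 0 0 0 y = xp (int y)"
    using assms unfolding nonmult_list_def by (blast intro: xweight_0)
  then have "prod_list (map (xweight 0 0 0 0) ys) = xp (int (sum_list ys))"
    by (induction ys) (auto simp: xp_mult)
  then show ?thesis by (simp add: list_weight_def)
qed

text \<open>Lowering each of the m multiples by 15 changes the least allowed value from 45 to 30 and
  the sum by 15 m, which is the factor \<open>inverse (xp 15) ^ m\<close>.\<close>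

lemma mult_gf_flag_nth:
  "fls_nth (mult_gf (xp 15) (xp (- 15)) m * (if flag then inverse (xp 15) ^ m else 1)) n
    = (if n < 0 then 0 else of_nat (card (mult_lists (if flag then 30 else 45) m (nat n))))"
proof (cases flag)
  case True
  have "fls_nth (mult_gf (xp 15) (xp (- 15)) m * inverse (xp 15) ^ m) n
      = fls_nth (mult_gf (xp 15) (xp (- 15)) m) (n + 15 * int m)"
    by (subst mult.commute) (simp add: inverse_xp xp_power xp_times_nth mult.commute)
  also have "\<dots> = (if n < 0 then 0 else of_nat (card (mult_lists 30 m (nat n))))"
  proof (cases "n < 0")
    case True
    \<comment> \<open>For negative n there would be m parts of at least 45 with a sum below 15
      m.\<close>
    have "card (mult_lists 45 m (nat (n + 15 * int m))) = 0" if "0 \<le> n + 15 * int m"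
    proof -
      have "0 < m" using True that by (cases m) auto
      then have "nat (n + 15 * int m) < 45 * m" using True that by simp
      then show ?thesis by (simp add: mult_lists_empty)
    qed
    then show ?thesis using True by (simp add: mult_gf_nth)
  next
    case False
    then have "nat (n + 15 * int m) = nat n + 15 * 1 * m" by auto
    then show ?thesis
      using False card_mult_lists_shift[of 30 1 m "nat n"] by (simp add: mult_gf_nth)
  qed
  finally show ?thesis using True by simp
qed (simp add: mult_gf_nth)

lemma pgf_0_nth:
  "fls_nth (pgf 0 0 0 0 M) (int n) = of_nat (\<Sum>m | 2 * m \<le> M. \<Sum>ys\<in>{ys \<in> nonmult_lists (30 * m) (15 * M - 1). sum_list ys \<le> n}.
     card (mult_lists (if 30 * m + 7 \<in> set ys then 30 else 45) m (n - sum_list ys)))"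
proof -
  let ?s = "\<lambda>m. inverse (xp 15) ^ m" and ?A = "\<lambda>m. nonmult_lists (30 * m) (15 * M - 1)"
  let ?c = "\<lambda>m ys. card (mult_lists (if 30 * m + 7 \<in> set ys then 30 else 45) m (n - sum_list ys))"
  have "fls_nth (mult_gf (xp 15) (xp (- 15)) m * list_weight (xweight 0 0 0 0) (?s m) (30 * m) ys) (int n)
      = (if sum_list ys \<le> n then of_nat (?c m ys) else 0)" if "ys \<in> ?A m" for m ys
  proof -
    have "nonmult_list (30 * m) ys" using that by (simp add: nonmult_lists_def)
    have "nat (int n - int (sum_list ys)) = n - sum_list ys" by simp
    have "fls_nth (mult_gf (xp 15) (xp (- 15)) m * list_weight (xweight 0 0 0 0) (?s m) (30 * m) ys) (int n)
      = fls_nth (xp (int (sum_list ys)) * (mult_gf (xp 15) (xp (- 15)) m * (if 30 * m + 7 \<in> set ys then ?s m else 1))) (int n)"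
      unfolding list_weight_xp[OF \<open>nonmult_list (30 * m) ys\<close>] by (simp only: mult_ac)
    also have "\<dots> = (if sum_list ys \<le> n then of_nat (?c m ys) else 0)"
      unfolding xp_times_nth mult_gf_flag_nth by (auto simp: nat_diff_distrib)
    finally show ?thesis .
  qed
  note * = this
  have fin: "finite (?A m)" for m
    using nonmult_gf_eq_sum[of m "15 * M - 1"] by blast
  have e: "15 * int (0 + 0 + 0 + 0) - 15 = - 15" by simp
  have "fls_nth (pgf 0 0 0 0 M) (int n) = (\<Sum>m | 2 * m \<le> M. \<Sum>ys\<in>?A m.
      fls_nth (mult_gf (xp 15) (xp (- 15)) m * list_weight (xweight 0 0 0 0) (?s m) (30 * m) ys) (int n))"
    unfolding pgf_def partial_gf_def xp_colours nonmult_gf_eq_sum[THEN conjunct2] e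
    by (simp only: fls_nth_sum sum_distrib_left)
  also have "\<dots> = (\<Sum>m | 2 * m \<le> M. \<Sum>ys\<in>?A m. if sum_list ys \<le> n then of_nat (?c m ys) else 0)"
    by (intro sum.cong refl *)
  also have "\<dots> = of_nat (\<Sum>m | 2 * m \<le> M. \<Sum>ys\<in>{ys \<in> ?A m. sum_list ys \<le> n}. ?c m ys)"
    unfolding sum.inter_filter[OF fin] of_nat_sum by (intro sum.cong refl) simp
  finally show ?thesis .
qed

lemma card_shifted_pairs: "of_nat (card (shifted_pairs n)) = fps_nth (limit_gf 0 0 0 0) n"
proof -
  define M where "M = Suc n"
  let ?A = "\<lambda>m. {ys \<in> nonmult_lists (30 * m) (15 * M - 1). sum_list ys \<le> n}"
  let ?I = "{m. 2 * m \<le> M}"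
  let ?B = "\<lambda>m ys. mult_lists (if 30 * m + 7 \<in> set ys then 30 else 45) m (n - sum_list ys)"
  have finI: "finite ?I"
    by (rule finite_subset[of _ "{..M}"]) auto
  have finA: "finite (?A m)" for m
    using nonmult_gf_eq_sum[THEN conjunct1] by (intro finite_Collect_conjI disjI1) simp
  have eq: "shifted_pairs n = (\<lambda>(m, ys, ms). (ys, ms)) ` (SIGMA m:?I. SIGMA ys:?A m. ?B m ys)"
  proof (intro set_eqI iffI)
    fix p assume "p \<in> shifted_pairs n"
    then obtain ys ms where p: "p = (ys, ms)" and ys: "nonmult_list (30 * length ms) ys"
      and ms: "ms \<in> mult_lists (if 30 * length ms + 7 \<in> set ys then 30 else 45) (length ms) (sum_list ms)"
      and sum: "sum_list ys + sum_list ms = n"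
      by (auto simp: shifted_pairs_def)
    \<comment> \<open>Every multiple is at least 30, so a pair of total n automatically obeys both
      cutoffs in \<open>pgf\<close> at M = n + 1.\<close>
    have "30 * length ms \<le> sum_list ms"
      using ms by (intro sum_list_ge) (auto simp: mult_lists_def split: if_splits)
    then have "length ms \<in> ?I"
      using sum by (simp add: M_def)
    moreover have "y \<le> 15 * M - 1" if "y \<in> set ys" for y
      using member_le_sum_list[OF that] sum by (simp add: M_def)
    then have "ys \<in> ?A (length ms)"
      using ys sum by (simp add: nonmult_lists_def)
    moreover have "n - sum_list ys = sum_list ms"
      using sum by simp
    then have "ms \<in> ?B (length ms) ys"
      using ms by simp
    ultimately have "(length ms, ys, ms) \<in> (SIGMA m:?I. SIGMA ys:?A m. ?B m ys)"
      by blast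
    then show "p \<in> (\<lambda>(m, ys, ms). (ys, ms)) ` (SIGMA m:?I. SIGMA ys:?A m. ?B m ys)"
      unfolding p by (rule rev_image_eqI) simp
  next
    fix p assume "p \<in> (\<lambda>(m, ys, ms). (ys, ms)) ` (SIGMA m:?I. SIGMA ys:?A m. ?B m ys)"
    then obtain m ys ms where p: "p = (ys, ms)" "ys \<in> ?A m" "ms \<in> ?B m ys"
      by auto
    then have "length ms = m" "sum_list ms = n - sum_list ys"
      by (simp_all add: mult_lists_def)
    with p show "p \<in> shifted_pairs n"
      by (simp add: shifted_pairs_def nonmult_lists_def)
  qed
  have "inj_on (\<lambda>(m, ys, ms). (ys, ms)) (SIGMA m:?I. SIGMA ys:?A m. ?B m ys)"
    by (rule inj_onI) (auto simp: mult_lists_def)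
  then have "card (shifted_pairs n) = card (SIGMA m:?I. SIGMA ys:?A m. ?B m ys)"
    unfolding eq by (rule card_image)
  also have "\<dots> = (\<Sum>m\<in>?I. \<Sum>ys\<in>?A m. card (?B m ys))"
    using finI finA by (simp add: finite_mult_lists finite_SigmaI)
  finally show ?thesis
    unfolding limit_gf_nth[of n M, symmetric, unfolded M_def, simplified] M_def pgf_0_nth by simp
qed

section \<open>Partitions counted by \<open>G\<close> and the shifting bijection\<close>

definition nonmult_part :: "nat list \<Rightarrow> nat list" where
  "nonmult_part = filter (\<lambda>x. \<not> 15 dvd x)"

definition mult_part :: "nat list \<Rightarrow> nat list" where
  "mult_part = filter (\<lambda>x. 15 dvd x)"

text \<open>Two successive gaps add up to at least 30, so the clause on distance 15 is vacuous for
  the composite.\<close>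

lemma transp_nonmult_gap: "transp nonmult_gap"
  by (auto simp: transp_def nonmult_gap_def)

lemma transp_mult_gap: "transp mult_gap"
  by (auto simp: transp_def mult_gap_def)

lemma nonmult_list_sorted: "nonmult_list L ys \<Longrightarrow> sorted ys"
  unfolding nonmult_list_def by (auto simp: nonmult_gap_def elim!: sorted_wrt_mono_rel[rotated])

lemma sorted_mult_gap: "sorted_wrt mult_gap ms \<Longrightarrow> sorted ms"
  by (auto simp: mult_gap_def elim!: sorted_wrt_mono_rel[rotated])

text \<open>By transitivity the conditions on consecutive entries become \<open>sorted_wrt\<close>,
  and in a sorted list the bound on the least multiple becomes a bound on all of them.\<close>

lemma G_cond_iff:
  "G_cond xs \<and> (\<forall>x\<in>set xs. 0 < x) \<longleftrightarrow> nonmult_list 0 (nonmult_part xs) \<and> sorted_wrt mult_gap (mult_part xs) \<and>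
     (\<forall>x\<in>set (mult_part xs). (if 7 \<in> set (nonmult_part xs) then 30 else 45) + 30 * length (nonmult_part xs) \<le> x)"
  (is "?lhs \<longleftrightarrow> ?rhs")
proof -
  define ys ms where "ys = nonmult_part xs" and "ms = mult_part xs"
  have xs: "set xs = set ys \<union> set ms" and ys: "\<forall>y\<in>set ys. \<not> 15 dvd y" and ms: "\<forall>y\<in>set ms. 15 dvd y"
    by (auto simp: ys_def ms_def nonmult_part_def mult_part_def)
  have seven: "7 \<in> set xs \<longleftrightarrow> 7 \<in> set ys"
    by (simp add: ys_def nonmult_part_def)
  have gap1: "(\<forall>i. Suc i < length ys \<longrightarrow> ys ! i + 15 \<le> ys ! Suc i \<and> (ys ! Suc i = ys ! i + 15 \<longrightarrow> coprime (ys ! i) 15))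
      \<longleftrightarrow> sorted_wrt nonmult_gap ys"
    unfolding successively_conv_sorted_wrt[OF transp_nonmult_gap, symmetric] successively_conv_nth nonmult_gap_def ..
  have gap2: "(\<forall>i. Suc i < length ms \<longrightarrow> ms ! i + 60 \<le> ms ! Suc i) \<longleftrightarrow> sorted_wrt mult_gap ms"
    unfolding successively_conv_sorted_wrt[OF transp_mult_gap, symmetric] successively_conv_nth mult_gap_def ..
  have hd: "(ms \<noteq> [] \<longrightarrow> c \<le> hd ms) \<longleftrightarrow> (\<forall>x\<in>set ms. c \<le> x)" if "sorted_wrt mult_gap ms" for c
    using sorted_mult_gap[OF that] by (cases ms) auto
  define c where "c = (if 7 \<in> set ys then 30 else 45 :: nat) + 30 * length ys"
  have c: "(if 7 \<in> set xs then 30 + 30 * length ys else 45 + 30 * length ys) = c"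
    unfolding seven c_def by simp
  have G: "G_cond xs \<longleftrightarrow> (\<forall>x\<in>set xs. x mod 15 \<notin> {1, 2, 4, 8}) \<and> sorted_wrt nonmult_gap ys \<and>
      (\<forall>x\<in>set xs. \<not> coprime x 15 \<longrightarrow> 15 < x) \<and> sorted_wrt mult_gap ms \<and> (ms \<noteq> [] \<longrightarrow> c \<le> hd ms)"
    unfolding G_cond_def Let_def nonmult_part_def[symmetric] mult_part_def[symmetric] ys_def[symmetric] ms_def[symmetric]
      gap1 gap2 c ..
  have ymod: "y mod 15 \<noteq> 0 \<and> 0 < y" if "y \<in> set ys" for y
    using ys that by (auto simp: dvd_eq_mod_eq_0 intro!: gr0I)
  have mmod: "y mod 15 = 0" if "y \<in> set ms" for y
    using ms that by auto
  \<comment> \<open>The bound (iv) puts every multiple above 15, so condition (ii) and positivity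
    remain to be checked only for the non-multiples.\<close>
  have c15: "15 < c" by (simp add: c_def)
  have res: "(\<forall>x\<in>set xs. x mod 15 \<notin> {1, 2, 4, 8}) \<longleftrightarrow> (\<forall>x\<in>set ys. x mod 15 \<notin> {0, 1, 2, 4, 8})"
    unfolding xs using ymod mmod by auto
  have big: "(\<forall>x\<in>set xs. \<not> coprime x 15 \<longrightarrow> 15 < x) \<and> (\<forall>x\<in>set xs. 0 < x)
      \<longleftrightarrow> (\<forall>x\<in>set ys. 0 < x \<and> (\<not> coprime x 15 \<longrightarrow> 15 < x))" if "\<forall>x\<in>set ms. c \<le> x"
  proof -
    have "15 < x \<and> 0 < x" if "x \<in> set ms" for x
      using c15 \<open>\<forall>x\<in>set ms. c \<le> x\<close> that by force
    then show ?thesis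
      unfolding xs by blast
  qed
  \<comment> \<open>\<open>hd\<close> holds only under the gap condition and \<open>big\<close> only
    under the lower bound, so each equivalence is used relative to that conjunct.\<close>
  have rearrange: "((A \<and> S \<and> B \<and> S' \<and> H) \<and> Z) = (A \<and> S \<and> S' \<and> C \<and> D)"
    if "S' \<Longrightarrow> H = C" "C \<Longrightarrow> (B \<and> Z) = D" for A B C D S S' H Z
    using that by blast
  have "G_cond xs \<and> (\<forall>x\<in>set xs. 0 < x) \<longleftrightarrow> (\<forall>x\<in>set ys. x mod 15 \<notin> {0, 1, 2, 4, 8}) \<and>
      sorted_wrt nonmult_gap ys \<and> sorted_wrt mult_gap ms \<and> (\<forall>x\<in>set ms. c \<le> x) \<and>
      (\<forall>x\<in>set ys. 0 < x \<and> (\<not> coprime x 15 \<longrightarrow> 15 < x))"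
    unfolding G res by (rule rearrange[OF hd big])
  also have "\<dots> \<longleftrightarrow> nonmult_list 0 ys \<and> sorted_wrt mult_gap ms \<and> (\<forall>x\<in>set ms. c \<le> x)"
    unfolding nonmult_list_def by auto
  finally show ?thesis
    unfolding ys_def[symmetric] ms_def[symmetric] c_def .
qed

lemma nonmult_list_shift: "nonmult_list (30 * n) (map (\<lambda>y. y + 30 * n) ys) \<longleftrightarrow> nonmult_list 0 ys"
proof -
  have m: "(y + 30 * n) mod 15 = y mod 15" for y
    using mod_mult_self2[of y 15 "2 * n"] by (simp add: mult.assoc[symmetric])
  have c: "coprime (y + 30 * n) 15 \<longleftrightarrow> coprime y 15" for y
    unfolding coprime_15_iff m ..
  have g: "nonmult_gap (y + 30 * n) (x + 30 * n) \<longleftrightarrow> nonmult_gap y x" for x y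
    by (simp add: nonmult_gap_def c)
  show ?thesis
    unfolding nonmult_list_def sorted_wrt_map g by (simp add: m c)
qed

definition split_shift :: "nat list \<Rightarrow> nat list \<times> nat list" where
  "split_shift xs = (map (\<lambda>y. y + 30 * length (mult_part xs)) (nonmult_part xs),
     map (\<lambda>x. x - 30 * length (nonmult_part xs)) (mult_part xs))"

definition merge_shift :: "nat list \<times> nat list \<Rightarrow> nat list" where
  "merge_shift = (\<lambda>(ys, ms). sort (map (\<lambda>y. y - 30 * length ms) ys @ map (\<lambda>x. x + 30 * length ys) ms))"

definition G_lists :: "nat \<Rightarrow> nat list set" where
  "G_lists n = {xs. sorted xs \<and> (\<forall>x\<in>set xs. 0 < x) \<and> sum_list xs = n \<and> G_cond xs}"

lemma mset_parts: "mset (nonmult_part xs @ mult_part xs) = mset xs"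
  unfolding nonmult_part_def mult_part_def by (induction xs) auto

lemma split_shift_in:
  assumes "xs \<in> G_lists n"
  shows "split_shift xs \<in> shifted_pairs n" and "merge_shift (split_shift xs) = xs"
proof -
  define ys ms where "ys = nonmult_part xs" and "ms = mult_part xs"
  define ms' where "ms' = map (\<lambda>x. x - 30 * length ys) ms"
  have G: "nonmult_list 0 ys" "sorted_wrt mult_gap ms"
      "\<forall>x\<in>set ms. (if 7 \<in> set ys then 30 else 45) + 30 * length ys \<le> x" and xs: "sorted xs" "sum_list xs = n"
    using assms G_cond_iff[of xs] unfolding ys_def ms_def G_lists_def by blast+
  have dvd: "\<forall>x\<in>set ms. 15 dvd x"
    by (simp add: ms_def mult_part_def)
  \<comment> \<open>Every multiple is at least 30 \<open>length ys\<close>, so the truncated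
    subtraction in \<open>split_shift\<close> is exact.\<close>
  have ms: "ms = map (\<lambda>x. x + 30 * length ys) ms'"
    unfolding ms'_def map_map comp_def by (rule map_idI[symmetric]) (use G(3) in fastforce)
  have sum: "sum_list ys + sum_list ms = n"
    using arg_cong[OF mset_parts[of xs], of sum_mset] xs(2) by (simp add: ys_def ms_def sum_mset_sum_list)
  have seven: "30 * length ms + 7 \<in> set (map (\<lambda>y. y + 30 * length ms) ys) \<longleftrightarrow> 7 \<in> set ys"
    by force
  have len: "length ms = length ms'" by (simp add: ms'_def)
  have "ms' \<in> mult_lists (if 7 \<in> set ys then 30 else 45) (length ms') (sum_list ms')"
    using G(2,3) dvd unfolding ms
    by (auto simp: mult_lists_def sorted_wrt_map mult_gap_add dvd_add_left_iff)
  \<comment> \<open>The non-multiples gain 30 times the product of the two lengths, and the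
    multiples lose the same amount.\<close>
  moreover have "sum_list (map (\<lambda>y. y + 30 * length ms) ys) + sum_list ms' = n"
    using sum unfolding sum_list_map_add len by (subst (asm) ms) (simp add: sum_list_map_add algebra_simps)
  ultimately show "split_shift xs \<in> shifted_pairs n"
    using G(1) seven unfolding split_shift_def ys_def[symmetric] ms_def[symmetric] ms'_def[symmetric]
      shifted_pairs_def len by (simp add: nonmult_list_shift)
  have "merge_shift (split_shift xs) = sort (ys @ ms)"
    unfolding split_shift_def ys_def[symmetric] ms_def[symmetric] ms'_def[symmetric] merge_shift_def
    by (simp add: len comp_def flip: ms)
  also have "\<dots> = xs"
    unfolding ys_def ms_def by (rule properties_for_sort[OF mset_parts[symmetric] xs(1)])
  finally show "merge_shift (split_shift xs) = xs" .
qed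

lemma merge_shift_in:
  assumes "p \<in> shifted_pairs n"
  shows "merge_shift p \<in> G_lists n" and "split_shift (merge_shift p) = p"
proof -
  obtain ys' ms' where p: "p = (ys', ms')"
    by (cases p)
  define ys ms where "ys = map (\<lambda>y. y - 30 * length ms') ys'" and "ms = map (\<lambda>x. x + 30 * length ys') ms'"
  have p': "nonmult_list (30 * length ms') ys'"
    "ms' \<in> mult_lists (if 30 * length ms' + 7 \<in> set ys' then 30 else 45) (length ms') (sum_list ms')"
    "sum_list ys' + sum_list ms' = n"
    using assms by (auto simp: p shifted_pairs_def)
  \<comment> \<open>Entries of \<open>ys'\<close> exceed 30 \<open>length ms'\<close>, so the
    subtraction in \<open>merge_shift\<close> is exact.\<close>
  have ys': "ys' = map (\<lambda>y. y + 30 * length ms') ys"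
    unfolding ys_def map_map comp_def by (rule map_idI[symmetric]) (use p'(1) in \<open>fastforce simp: nonmult_list_def\<close>)
  have len: "length ys' = length ys" "length ms' = length ms"
    by (simp_all add: ys_def ms_def)
  have ms': "ms' = map (\<lambda>x. x - 30 * length ys') ms"
    by (simp add: ms_def comp_def)
  have ys: "nonmult_list 0 ys"
    using p'(1) by (subst (asm) ys') (simp only: nonmult_list_shift)
  have seven: "30 * length ms' + 7 \<in> set ys' \<longleftrightarrow> 7 \<in> set ys"
    unfolding ys' by force
  have ms: "sorted_wrt mult_gap ms" "\<forall>x\<in>set ms. 15 dvd x"
    "\<forall>x\<in>set ms. (if 7 \<in> set ys then 30 else 45) + 30 * length ys \<le> x"
    using p'(2) unfolding seven mult_lists_def ms_def len(1)
    by (auto simp: sorted_wrt_map mult_gap_add)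
  have ndvd: "\<forall>y\<in>set ys. \<not> 15 dvd y"
    using ys by (auto simp: nonmult_list_def dvd_eq_mod_eq_0)
  have merge: "merge_shift p = sort (ys @ ms)"
    by (simp add: p merge_shift_def ys_def ms_def)
  \<comment> \<open>Filtering commutes with sorting, and \<open>ys\<close> and \<open>ms\<close> are
    already sorted, so each comes back unchanged.\<close>
  have parts: "nonmult_part (merge_shift p) = ys" "mult_part (merge_shift p) = ms"
    using ndvd ms(2) sorted_sort_id[OF nonmult_list_sorted[OF ys]] sorted_sort_id[OF sorted_mult_gap[OF ms(1)]]
    unfolding merge nonmult_part_def mult_part_def filter_sort by (simp_all add: filter_id_conv filter_empty_conv)
  have "sum_list (merge_shift p) = sum_list ys + sum_list ms"
    unfolding merge by (metis mset_sort sum_list_append sum_mset_sum_list)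
  also have "\<dots> = n"
    using p'(3) unfolding ms_def len(1) by (subst (asm) ys') (simp add: sum_list_map_add algebra_simps)
  finally have "sum_list (merge_shift p) = n" .
  moreover have "G_cond (merge_shift p) \<and> (\<forall>x\<in>set (merge_shift p). 0 < x)"
    unfolding G_cond_iff parts using ys ms(1,3) by blast
  moreover have "sorted (merge_shift p)"
    unfolding merge by simp
  ultimately show "merge_shift p \<in> G_lists n"
    unfolding G_lists_def by blast
  show "split_shift (merge_shift p) = p"
    unfolding split_shift_def parts len(2)[symmetric] len(1)[symmetric] ys'[symmetric] ms'[symmetric]
    by (rule p[symmetric])
qed

theorem theorem1:
  fixes n :: nat
  shows "G n = P n"
proof -
  have "bij_betw split_shift (G_lists n) (shifted_pairs n)"
    by (rule bij_betw_byWitness[where f' = merge_shift]) (use split_shift_in merge_shift_in in blast)+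
  then have "G n = card (shifted_pairs n)"
    unfolding G_def G_lists_def[symmetric] by (rule bij_betw_same_card)
  moreover have "of_nat (card (shifted_pairs n)) = (of_nat (P n) :: rat)"
    unfolding card_shifted_pairs limit_gf_eq_P ..
  ultimately show ?thesis
    by simp
qed

end
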